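(* Let $\mathbb{F}_q$ be a finite field with $q$ elements and $\operatorname{char}\mathbb{F}_q\neq 2$. For $j\in\{3,4,5,6,8,14,15,16,17,18,19\}$ let $M^{\mathrm{sm}}_j$ (respectively $M^{\mathrm{val}}_j$) be the number of smooth pairs (respectively valid pairs) in the pencil $\mathscr{P}_j$ that are $4$-Poncelet pairs. Then: \begin{itemize} \item for $j\in\{3,16\}$: $M^{\mathrm{sm}}_j=3(q-3)$ and $M^{\mathrm{val}}_j=3(q-2)$; \item for $j\in\{4,6,15,17\}$: $M^{\mathrm{sm}}_j=M^{\mathrm{val}}_j=q-1$; \item for $j\in\{5,8\}$: $M^{\mathrm{sm}}_j=M^{\mathrm{val}}_j=0$; \item for $j\in\{14,19\}$: $M^{\mathrm{sm}}_j=q-1$ and $M^{\mathrm{val}}_j=q$; \item for $j=18$: $M^{\mathrm{sm}}_j=M^{\mathrm{val}}_j=0$. \end{itemize}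
   Context: Conics. A conic in $\mathbf{P}^2(\mathbb{F}_q)$ is given by a nonzero quadratic form in $x,y,z$ over $\mathbb{F}_q$ (up to scalar), represented by its symmetric $3\times 3$ matrix; it is smooth if the matrix is invertible and singular otherwise. Singular conics are regarded over the algebraic closure $\overline{\mathbb{F}_q}$: each is either a double line or a union of two distinct lines defined over $\overline{\mathbb{F}_q}$ (a conic consisting of a single $\mathbb{F}_q$-point is the union of two conjugate lines). Pencils. The pencil $\mathscr{P}_j$ has two generators with matrices $A_j,B_j$; its elements are indexed by $\eta\in\mathbf{P}^1(\mathbb{F}_q)=\mathbb{F}_q\cup\{\infty\}$, the conic with parameter $\eta$ having matrix $C_j(\eta)=\eta A_j+B_j$, with $C_j(\infty)=A_j$. The generators (quadratic forms of $A_j$; of $B_j$) are: $\mathscr{P}_3$: $xy$; $xz+yz+z^2$. $\mathscr{P}_4$: $xy$; $xz+z^2$. $\mathscr{P}_5$: $xy$; $xz+y^2$. $\mathscr{P}_6$: $xy$; $z^2$. $\mathscr{P}_8$: $x^2$; $xy+z^2$. $\mathscr{P}_{14}$: $xy$; $xz+y^2+yz+ez^2$. $\mathscr{P}_{15}$: $xy$; $y^2+yz+ez^2$. $\mathscr{P}_{16}$: $xy$; $ex^2+xz+dy^2+yz+z^2$. $\mathscr{P}_{17}$: $x^2$; $y^2+yz+ez^2$. $\mathscr{P}_{18}$: $-xz+y^2$; $x^2+cxy+by^2+yz$. $\mathscr{P}_{19}$: $x^2-\nu y^2$; $2\sigma xy-\rho y^2+z^2$. Here $b,c,d,e,\nu,\rho,\sigma\in\mathbb{F}_q$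 are fixed so that $T^3+bT^2+cT+1$, $T^2+T+d$, $T^2+T+e$ are irreducible in $\mathbb{F}_q[T]$, and $\nu$ and $\rho^2-4\nu\sigma^2$ are non-squares in $\mathbb{F}_q$. Pairs. A pair $(\mathscr{A},\mathscr{B})$ of conics of $\mathscr{P}_j$ (an ordered pair, identified with its pair of parameters $(r,s)$) is valid if the two conics are distinct, $\mathscr{B}$ is smooth, and $\mathscr{A}$ is either smooth or the union of two distinct lines (over $\overline{\mathbb{F}_q}$) neither of which is tangent to $\mathscr{B}$. A smooth pair is an ordered pair of distinct smooth conics of the pencil. Poncelet pairs. $(\mathscr{A},\mathscr{B})$ is an $n$-Poncelet pair if, over $\overline{\mathbb{F}_q}$, there is an $n$-sided polygon inscribed in $\mathscr{A}$ and circumscribed about $\mathscr{B}$. For $n=4$ this is taken in the form of Cayley's criterion: if $A,B$ are the matrices of $\mathscr{A},\mathscr{B}$ and $\sqrt{\det(tA+B)}=H_0+H_1t+H_2t^2+H_3t^3+\cdots$ is the formal power series expansion over $\overline{\mathbb{F}_q}$ (either choice of square root), then $(\mathscr{A},\mathscr{B})$ is a $4$-Poncelet pair if and only if $H_3=0$. *)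

theory Defs
  imports
    "HOL-Analysis.Analysis"
    "HOL-Computational_Algebra.Computational_Algebra"
    "HOL-Algebra.Algebraic_Closure_Type"
begin

text \<open>Conics are represented by symmetric matrices. The Gram matrix of
  \<open>a x\<^sup>2 + b y\<^sup>2 + c z\<^sup>2 + f xy + g xz + h yz\<close> has halved off-diagonal coefficients,
  hence the restriction to characteristic other than 2 wherever it is used.\<close>

definition qf_matrix :: "'a::field \<Rightarrow> 'a \<Rightarrow> 'a \<Rightarrow> 'a \<Rightarrow> 'a \<Rightarrow> 'a \<Rightarrow> 'a^3^3" where
  "qf_matrix a b c f g h =
     vector [vector [a,   f/2, g/2],
             vector [f/2, b,   h/2],
             vector [g/2, h/2, c]]"

lemma qf_matrix_form:
  fixes a b c f g h x y z :: "'a::field"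
  assumes "(2::'a) \<noteq> 0"
  shows "scalar_product (vector [x, y, z]) (qf_matrix a b c f g h *v vector [x, y, z]) =
           a*x^2 + b*y^2 + c*z^2 + f*x*y + g*x*z + h*y*z"
proof -
  have half: "u / 2 + u / 2 = u" for u :: 'a
    using assms by (simp add: field_simps)
  have "scalar_product (vector [x, y, z]) (qf_matrix a b c f g h *v vector [x, y, z]) =
      a*x^2 + b*y^2 + c*z^2 + (f/2 + f/2)*x*y + (g/2 + g/2)*x*z + (h/2 + h/2)*y*z"
    unfolding scalar_product_def matrix_vector_mult_def qf_matrix_def
    by (simp add: sum_3 power2_eq_square algebra_simps)
  then show ?thesis
    by (simp only: half)
qed

definition smooth_conic :: "'a::field^3^3 \<Rightarrow> bool" where
  "smooth_conic A \<longleftrightarrow> invertible A"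

definition same_conic :: "'a::field^3^3 \<Rightarrow> 'a^3^3 \<Rightarrow> bool" where
  "same_conic A B \<longleftrightarrow> (\<exists>k. k \<noteq> 0 \<and> A = map_matrix ((*) k) B)"

text \<open>Points of the projective plane are given by nonzero coordinate vectors, and a point set is
  represented by the set of all coordinate vectors of its points. The next three notions are used
  over the algebraic closure only.\<close>

definition conic_points :: "'k::field^3^3 \<Rightarrow> ('k^3) set" where
  "conic_points A = {v. v \<noteq> 0 \<and> scalar_product v (A *v v) = 0}"

definition line_points :: "'k::field^3 \<Rightarrow> ('k^3) set" where
  "line_points l = {v. v \<noteq> 0 \<and> scalar_product l v = 0}"

text \<open>The tangent line to a smooth conic at a point \<open>p\<close> has coefficient vector \<open>B p\<close>.\<close>

definition tangent_line :: "'k::field^3 \<Rightarrow> 'k^3^3 \<Rightarrow> bool" where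
  "tangent_line l B \<longleftrightarrow> (\<exists>p \<in> conic_points B. line_points l = line_points (B *v p))"

abbreviation to_closure :: "'a::field^3^3 \<Rightarrow> 'a alg_closure^3^3" where
  "to_closure \<equiv> map_matrix to_ac"

definition smooth_pair :: "'a::field^3^3 \<Rightarrow> 'a^3^3 \<Rightarrow> bool" where
  "smooth_pair A B \<longleftrightarrow> \<not> same_conic A B \<and> smooth_conic A \<and> smooth_conic B"

definition valid_pair :: "'a::field^3^3 \<Rightarrow> 'a^3^3 \<Rightarrow> bool" where
  "valid_pair A B \<longleftrightarrow> \<not> same_conic A B \<and> smooth_conic B \<and>
     (smooth_conic A \<or>
      (\<exists>l m. l \<noteq> 0 \<and> m \<noteq> 0 \<and> line_points l \<noteq> line_points m \<and>
         conic_points (to_closure A) = line_points l \<union> line_points m \<and>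
         \<not> tangent_line l (to_closure B) \<and> \<not> tangent_line m (to_closure B)))"

text \<open>Cayley's criterion. If \<open>B\<close> is smooth and the characteristic is not 2, the square root exists
  and is unique up to sign, so the existential quantifier is harmless.\<close>

definition pencil_det :: "'k::field^3^3 \<Rightarrow> 'k^3^3 \<Rightarrow> 'k fps" where
  "pencil_det A B = det (\<chi> i j. fps_X * fps_const (A $ i $ j) + fps_const (B $ i $ j))"

definition poncelet4_pair :: "'a::field^3^3 \<Rightarrow> 'a^3^3 \<Rightarrow> bool" where
  "poncelet4_pair A B \<longleftrightarrow>
     (\<exists>H :: 'a alg_closure fps.
        H^2 = pencil_det (to_closure A) (to_closure B) \<and> fps_nth H 3 = 0)"

text \<open>A pencil is given by its two generators. Its parameters, the elements of the projective line
  \<open>F \<union> {\<infinity>}\<close>, have type \<open>'a option\<close>, where \<open>None\<close> is the point at infinity.\<close>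

type_synonym 'a pencil = "('a^3^3) \<times> ('a^3^3)"

fun pencil_conic :: "'a::field pencil \<Rightarrow> 'a option \<Rightarrow> 'a^3^3" where
  "pencil_conic (A, B) (Some \<eta>) = map_matrix ((*) \<eta>) A + B"
| "pencil_conic (A, B) None = A"

definition M_sm :: "'a::{field,finite} pencil \<Rightarrow> nat" where
  "M_sm P = card {(r, s). smooth_pair (pencil_conic P r) (pencil_conic P s) \<and>
                          poncelet4_pair (pencil_conic P r) (pencil_conic P s)}"

definition M_val :: "'a::{field,finite} pencil \<Rightarrow> nat" where
  "M_val P = card {(r, s). valid_pair (pencil_conic P r) (pencil_conic P s) \<and>
                           poncelet4_pair (pencil_conic P r) (pencil_conic P s)}"

text \<open>Arguments of \<open>qf_matrix\<close>: the coefficients of \<open>x\<^sup>2, y\<^sup>2, z\<^sup>2, xy, xz, yz\<close>, in this order.\<close>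

definition P3 :: "'a::field pencil" where
  "P3 = (qf_matrix 0 0 0 1 0 0, qf_matrix 0 0 1 0 1 1)"

definition P4 :: "'a::field pencil" where
  "P4 = (qf_matrix 0 0 0 1 0 0, qf_matrix 0 0 1 0 1 0)"

definition P5 :: "'a::field pencil" where
  "P5 = (qf_matrix 0 0 0 1 0 0, qf_matrix 0 1 0 0 1 0)"

definition P6 :: "'a::field pencil" where
  "P6 = (qf_matrix 0 0 0 1 0 0, qf_matrix 0 0 1 0 0 0)"

definition P8 :: "'a::field pencil" where
  "P8 = (qf_matrix 1 0 0 0 0 0, qf_matrix 0 0 1 1 0 0)"

definition P14 :: "'a::field \<Rightarrow> 'a pencil" where
  "P14 e = (qf_matrix 0 0 0 1 0 0, qf_matrix 0 1 e 0 1 1)"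

definition P15 :: "'a::field \<Rightarrow> 'a pencil" where
  "P15 e = (qf_matrix 0 0 0 1 0 0, qf_matrix 0 1 e 0 0 1)"

definition P16 :: "'a::field \<Rightarrow> 'a \<Rightarrow> 'a pencil" where
  "P16 d e = (qf_matrix 0 0 0 1 0 0, qf_matrix e d 1 0 1 1)"

definition P17 :: "'a::field \<Rightarrow> 'a pencil" where
  "P17 e = (qf_matrix 1 0 0 0 0 0, qf_matrix 0 1 e 0 0 1)"

definition P18 :: "'a::field \<Rightarrow> 'a \<Rightarrow> 'a pencil" where
  "P18 b c = (qf_matrix 0 1 0 0 (-1) 0, qf_matrix 1 b 0 c 0 1)"

definition P19 :: "'a::field \<Rightarrow> 'a \<Rightarrow> 'a \<Rightarrow> 'a pencil" where
  "P19 \<nu> \<rho> \<sigma> = (qf_matrix 1 (-\<nu>) 0 0 0 0, qf_matrix 0 (-\<rho>) 1 (2 * \<sigma>) 0 0)"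

end

theory Submission
  imports Defs
begin

text \<open>The counts depend only on the cubic form \<open>det (u A + v B)\<close> of the pencil, for two reasons.

  First, write \<open>d\<^sub>0 + d\<^sub>1 t + d\<^sub>2 t\<^sup>2 + d\<^sub>3 t\<^sup>3\<close> for \<open>det (t C
  + D)\<close>, where \<open>C\<close> and \<open>D\<close> are the members of the pencil with parameters
  \<open>r\<close> and \<open>s\<close>, and \<open>D\<close> is smooth. Expanding the square root shows that
  \<open>(C, D)\<close> is a 4-Poncelet pair exactly when \<open>d\<^sub>1\<^sup>3 - 4 d\<^sub>0 d\<^sub>1 d\<^sub>2 +
  8 d\<^sub>0\<^sup>2 d\<^sub>3 = 0\<close> (\<open>poncelet4_pair_iff\<close>), and the left-hand side is, up to the
  factor \<open>- d\<^sub>0\<close>, the determinant of the member \<open>d\<^sub>1 D - 2 d\<^sub>0 C\<close>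
  (\<open>det_comb_cayley4\<close>). For fixed \<open>D\<close> the map from \<open>C\<close> to that member is an
  invertible linear map on homogeneous parameters, so each smooth \<open>s\<close> belongs to as many Poncelet pairs
  as the pencil has singular members. If their number is \<open>N\<close>, there are \<open>N (q + 1 - N)\<close>
  Poncelet pairs with smooth second member (\<open>card_poncelet_params\<close>).

  Second, let \<open>C\<close> be singular, so that \<open>d\<^sub>3 = 0\<close> and the condition reads
  \<open>d\<^sub>1 (d\<^sub>1\<^sup>2 - 4 d\<^sub>0 d\<^sub>2) = 0\<close>. Over the closure \<open>C\<close> is a
  pair of lines \<open>l, m\<close>, and the discriminant \<open>d\<^sub>1\<^sup>2 - 4 d\<^sub>0 d\<^sub>2\<close> is
  four times the product of the values of the dual form of \<open>D\<close> at \<open>l\<close> and \<open>m\<close>;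
  it vanishes exactly when one of them is tangent to \<open>D\<close> (\<open>discriminant_line_pair\<close>,
  \<open>tangent_line_iff\<close>). A Poncelet pair with singular \<open>C\<close> is therefore valid exactly when
  \<open>d\<^sub>1 = 0\<close> and \<open>d\<^sub>2 \<noteq> 0\<close> (\<open>valid_pair_singular_iff\<close>).

  It remains to subtract from \<open>N (q + 1 - N)\<close> the pairs with singular \<open>C\<close>, and to add back
  the valid ones, according to the position of the roots of the cubic. A simple root with two further distinct roots,
  rational or conjugate, is the first member of exactly one Poncelet pair: the second member is its harmonic conjugate
  with respect to those two, and the pair is valid. In the presence of a multiple root no pair with singular
  \<open>C\<close> is valid. The pencils have three rational roots (\<open>P3\<close>, \<open>P16\<close>), one
  rational root and two conjugate ones (\<open>P14\<close>, \<open>P19\<close>), a double and a simple root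
  (\<open>P4\<close>, \<open>P6\<close>, \<open>P15\<close>, \<open>P17\<close>), a triple root (\<open>P5\<close>,
  \<open>P8\<close>), or no rational root (\<open>P18\<close>).\<close>

(* From here on "$" denotes vector components only. *)
no_notation fps_nth (infixl "$" 75)

section \<open>Mixed determinants\<close>

text \<open>The coefficient of \<open>t\<close> in \<open>det (t A + B)\<close>, as the sum over the three ways of
  replacing one row of \<open>B\<close> by the corresponding row of \<open>A\<close>. It is linear in \<open>A\<close>
  and quadratic in \<open>B\<close>.\<close>

definition mixed_det :: "'a::comm_ring_1^3^3 \<Rightarrow> 'a^3^3 \<Rightarrow> 'a" where
  "mixed_det A B = (\<Sum>k\<in>UNIV. det (\<chi> i. if i = k then A $ i else B $ i))"

definition comb :: "'a::comm_ring_1 \<Rightarrow> 'a^3^3 \<Rightarrow> 'a \<Rightarrow> 'a^3^3 \<Rightarrow> 'a^3^3" where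
  "comb u A v B = (\<chi> i j. u * A $ i $ j + v * B $ i $ j)"

lemma mixed_det_expand:
  "mixed_det A B =
    det (vector [A $ 1, B $ 2, B $ 3]) + det (vector [B $ 1, A $ 2, B $ 3]) +
    det (vector [B $ 1, B $ 2, A $ 3])"
  unfolding mixed_det_def sum_3 det_3 by simp

lemma det_comb:
  "det (comb u A v B) =
     u^3 * det A + u^2 * v * mixed_det B A + u * v^2 * mixed_det A B + v^3 * det B"
  unfolding mixed_det_expand comb_def det_3
  by (simp add: algebra_simps power2_eq_square power3_eq_cube)

lemma mixed_det_comb_left:
  "mixed_det (comb u A v B) C = u * mixed_det A C + v * mixed_det B C"
  unfolding mixed_det_expand comb_def det_3
  by (simp add: algebra_simps)

lemma mixed_det_self: "mixed_det A A = 3 * det A"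
  unfolding mixed_det_expand det_3
  by (simp add: algebra_simps)

lemma mixed_det_comb_right:
  "mixed_det A (comb u A v B) = 3 * u^2 * det A + 2 * u * v * mixed_det B A + v^2 * mixed_det A B"
  unfolding mixed_det_expand comb_def det_3
  by (simp add: algebra_simps power2_eq_square)

lemma mixed_det_comb_right':
  "mixed_det B (comb u A v B) = 3 * v^2 * det B + 2 * u * v * mixed_det A B + u^2 * mixed_det B A"
proof -
  have "comb u A v B = comb v B u A" by (simp add: comb_def add.commute)
  then show ?thesis by (simp add: mixed_det_comb_right ac_simps)
qed

text \<open>The determinant form of the pencil fixes the mixed determinants of any two of its members: the right-hand
  side is the gradient of the cubic of \<open>det_comb\<close> at \<open>(u', v')\<close>, paired with \<open>(u,
  v)\<close>.\<close>

lemma mixed_det_comb_comb: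
  "mixed_det (comb u A v B) (comb u' A v' B) =
     u * (3 * u'^2 * det A + 2 * u' * v' * mixed_det B A + v'^2 * mixed_det A B) +
     v * (3 * v'^2 * det B + 2 * u' * v' * mixed_det A B + u'^2 * mixed_det B A)"
  by (simp add: mixed_det_comb_left mixed_det_comb_right mixed_det_comb_right')

section \<open>Line pairs and the dual conic\<close>

text \<open>The matrix of the quadratic form \<open>2 (l \<bullet> v) (m \<bullet> v)\<close>.\<close>

definition line_pair :: "'k::field^3 \<Rightarrow> 'k^3 \<Rightarrow> 'k^3^3" where
  "line_pair l m = (\<chi> i j. l $ i * m $ j + m $ i * l $ j)"

definition adjugate3 :: "'k::field^3^3 \<Rightarrow> 'k^3^3" where
  "adjugate3 B = vector
    [vector [B$2$2 * B$3$3 - B$2$3 * B$3$2, B$1$3 * B$3$2 - B$1$2 * B$3$3, B$1$2 * B$2$3 - B$1$3 * B$2$2],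
     vector [B$2$3 * B$3$1 - B$2$1 * B$3$3, B$1$1 * B$3$3 - B$1$3 * B$3$1, B$1$3 * B$2$1 - B$1$1 * B$2$3],
     vector [B$2$1 * B$3$2 - B$2$2 * B$3$1, B$1$2 * B$3$1 - B$1$1 * B$3$2, B$1$1 * B$2$2 - B$1$2 * B$2$1]]"

text \<open>For smooth \<open>B\<close> this is the bilinear form, up to scalar, of the dual conic, whose points are
  the tangent lines of \<open>B\<close>.\<close>

definition dual_form :: "'k::field^3^3 \<Rightarrow> 'k^3 \<Rightarrow> 'k^3 \<Rightarrow> 'k" where
  "dual_form B l m = scalar_product l (adjugate3 B *v m)"

lemma mult_adjugate3: "B *v (adjugate3 B *v l) = det B *s l"
  unfolding vec_eq_iff forall_3
  by (simp add: adjugate3_def matrix_vector_mult_def sum_3 det_3 algebra_simps)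

lemma adjugate3_mult: "adjugate3 B *v (B *v l) = det B *s l"
  unfolding vec_eq_iff forall_3
  by (simp add: adjugate3_def matrix_vector_mult_def sum_3 det_3 algebra_simps)

lemma adjugate3_adjugate3: "adjugate3 (adjugate3 B) = (\<chi> i j. det B * B $ i $ j)"
  unfolding vec_eq_iff forall_3
  by (simp add: adjugate3_def det_3 algebra_simps)

lemma symmetric3:
  assumes "transpose B = (B::'k^3^3)"
  shows "B $ 2 $ 1 = B $ 1 $ 2" "B $ 3 $ 1 = B $ 1 $ 3" "B $ 3 $ 2 = B $ 2 $ 3"
proof -
  have "B $ i $ j = B $ j $ i" for i j
    using arg_cong[OF assms, of "\<lambda>M. M $ j $ i"] by (simp add: transpose_def)
  then show "B $ 2 $ 1 = B $ 1 $ 2" "B $ 3 $ 1 = B $ 1 $ 3" "B $ 3 $ 2 = B $ 2 $ 3"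
    by blast+
qed

lemma mixed_det_line_pair_left:
  assumes "transpose B = B"
  shows "mixed_det (line_pair l m) B = 2 * dual_form B l m"
  unfolding mixed_det_expand line_pair_def det_3 dual_form_def adjugate3_def matrix_vector_mult_def scalar_product_def sum_3
  by (simp add: symmetric3[OF assms] algebra_simps)

definition cross :: "'k::field^3 \<Rightarrow> 'k^3 \<Rightarrow> 'k^3" where
  "cross l m = vector [l$2 * m$3 - l$3 * m$2, l$3 * m$1 - l$1 * m$3, l$1 * m$2 - l$2 * m$1]"

lemma mixed_det_line_pair_right:
  assumes "transpose B = B"
  shows "mixed_det B (line_pair l m) = - scalar_product (cross l m) (B *v cross l m)"
  unfolding mixed_det_expand line_pair_def det_3 cross_def matrix_vector_mult_def scalar_product_def sum_3
  by (simp add: symmetric3[OF assms] algebra_simps)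

lemma scalar_product_cross_cross:
  "scalar_product (cross l m) (cross x y) =
     scalar_product l x * scalar_product m y - scalar_product l y * scalar_product m x"
  unfolding scalar_product_def sum_3 cross_def
  by (simp add: algebra_simps)

text \<open>The \<open>2 \<times> 2\<close> minors of the matrix with columns \<open>l, m\<close> transform by the
  second compound of \<open>C\<close>.\<close>

lemma cross_mult_mult:
  assumes "transpose C = C"
  shows "cross (C *v l) (C *v m) = adjugate3 C *v cross l m"
  unfolding vec_eq_iff forall_3 cross_def matrix_vector_mult_def adjugate3_def sum_3
  by (simp add: symmetric3[OF assms] algebra_simps)

lemma transpose_adjugate3:
  assumes "transpose B = B"
  shows "transpose (adjugate3 B) = adjugate3 B"
  unfolding vec_eq_iff forall_3 transpose_def adjugate3_def
  by (simp add: symmetric3[OF assms] algebra_simps)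

lemma scalar_product_mult_commute:
  fixes C :: "'k::field^3^3"
  assumes "transpose C = C"
  shows "scalar_product l (C *v m) = scalar_product m (C *v l)"
  unfolding scalar_product_def matrix_vector_mult_def sum_3
  by (simp add: symmetric3[OF assms] algebra_simps)

lemma adjugate3_adjugate3_mult: "adjugate3 (adjugate3 B) *v p = det B *s (B *v p)"
  unfolding adjugate3_adjugate3 vec_eq_iff matrix_vector_mult_def
  by (simp add: sum_distrib_left mult.assoc)

lemma scalar_product_scale_right:
  fixes k :: "'k::field"
  shows "scalar_product l (k *s m) = k * scalar_product l m"
  unfolding scalar_product_def by (simp add: sum_distrib_left ac_simps)

text \<open>If \<open>A\<close> is the pair of lines \<open>l, m\<close>, then \<open>det (t A + B)\<close> has degree
  at most 2, and its discriminant detects tangency: in characteristic other than 2 it vanishes exactly when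
  \<open>l\<close> or \<open>m\<close> lies on the dual conic of \<open>B\<close>. The identity is the Lagrange
  identity for the form \<open>adjugate3 B\<close>, whose own adjugate is \<open>det B\<close> times \<open>B\<close>;
  the vector \<open>cross l m\<close> is the common point of the two lines.\<close>

lemma discriminant_line_pair:
  assumes B: "transpose B = B"
  shows "(mixed_det (line_pair l m) B)\<^sup>2 - 4 * det B * mixed_det B (line_pair l m) =
    4 * dual_form B l l * dual_form B m m"
proof -
  define C where "C = adjugate3 B"
  have C: "transpose C = C"
    unfolding C_def by (rule transpose_adjugate3[OF B])
  have "scalar_product l (C *v l) * scalar_product m (C *v m) - scalar_product l (C *v m) * scalar_product m (C *v l) =
     scalar_product (cross l m) (cross (C *v l) (C *v m))"
    by (simp only: scalar_product_cross_cross)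
  also have "\<dots> = det B * scalar_product (cross l m) (B *v cross l m)"
    by (simp only: cross_mult_mult[OF C], simp only: C_def adjugate3_adjugate3_mult scalar_product_scale_right)
  finally have "dual_form B l l * dual_form B m m - (dual_form B l m)\<^sup>2 =
       det B * scalar_product (cross l m) (B *v cross l m)"
    unfolding dual_form_def C_def[symmetric]
    by (simp add: scalar_product_mult_commute[OF C, of m l] power2_eq_square)
  then have "dual_form B l l * dual_form B m m =
      (dual_form B l m)\<^sup>2 + det B * scalar_product (cross l m) (B *v cross l m)"
    by (simp add: diff_eq_eq add.commute)
  moreover have "(2 * dual_form B l m)\<^sup>2 - 4 * det B * - scalar_product (cross l m) (B *v cross l m) =
      4 * ((dual_form B l m)\<^sup>2 + det B * scalar_product (cross l m) (B *v cross l m))"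
    by (simp add: distrib_left power_mult_distrib mult.assoc)
  ultimately show ?thesis
    unfolding mixed_det_line_pair_left[OF B] mixed_det_line_pair_right[OF B]
    by (simp only: mult.assoc)
qed

section \<open>Incidence of points and lines\<close>

lemma vec3_eq_iff: "(v::'k^3) = w \<longleftrightarrow> v$1 = w$1 \<and> v$2 = w$2 \<and> v$3 = w$3"
  by (simp add: vec_eq_iff forall_3)

lemma scalar_product_3: "scalar_product v w = v$1 * w$1 + v$2 * w$2 + v$3 * (w::'k::semiring_1^3)$3"
  by (simp add: scalar_product_def sum_3)

lemma cross_eq_0_imp_proportional:
  fixes l m :: "'k::field^3"
  assumes "cross l m = 0" "l \<noteq> 0" "m \<noteq> 0"
  obtains k where "k \<noteq> 0" "m = k *s l"
proof -
  obtain i where i: "l $ i \<noteq> 0"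
    using \<open>l \<noteq> 0\<close> by (auto simp: vec_eq_iff)
  have *: "l $ i * m $ j = m $ i * l $ j" for j
    using assms(1) exhaust_3[of i] exhaust_3[of j]
    by (auto simp: cross_def vec3_eq_iff mult.commute)
  define k where "k = m $ i / l $ i"
  have m: "m = k *s l"
    using * i by (simp add: vec_eq_iff k_def field_simps)
  moreover have "k \<noteq> 0" using m \<open>m \<noteq> 0\<close> by auto
  ultimately show ?thesis using that by blast
qed

lemma scalar_product_add_right:
  "scalar_product l (p + q) = scalar_product l p + scalar_product l (q::'k::field^3)"
  by (simp add: scalar_product_3 algebra_simps)

lemma cross_cross_left: "cross (cross p q) l = scalar_product p l *s q - scalar_product q l *s (p::'k::field^3)"
  by (simp add: vec3_eq_iff scalar_product_3 cross_def algebra_simps)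

lemma scalar_product_commute: "scalar_product v w = scalar_product w (v::'k::field^3)"
  by (simp add: scalar_product_3 mult.commute)

lemma line_through_two_points:
  fixes l k :: "'k::field^3"
  assumes "l \<noteq> 0" "k \<noteq> 0" "cross p q \<noteq> 0"
    "scalar_product l p = 0" "scalar_product l q = 0"
    "scalar_product k p = 0" "scalar_product k q = 0"
  obtains c where "c \<noteq> 0" "l = c *s k"
proof -
  have "cross (cross p q) l = 0" "cross (cross p q) k = 0"
    using assms by (simp_all add: cross_cross_left scalar_product_commute)
  then obtain a b where "a \<noteq> 0" "l = a *s cross p q" "b \<noteq> 0" "k = b *s cross p q"
    using cross_eq_0_imp_proportional assms(1-3) by metis
  then have "a / b \<noteq> 0" "l = (a / b) *s k"
    by (auto simp: vec_eq_iff)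
  then show ?thesis by (rule that)
qed

lemma line_points_scale: "c \<noteq> 0 \<Longrightarrow> line_points (c *s k) = line_points (k::'k::field^3)"
  unfolding line_points_def scalar_product_commute[of _ k] scalar_product_commute[of "c *s k"]
  by (simp add: scalar_product_commute[of "c *s k"] scalar_product_scale_right scalar_product_commute[of k])

lemma two_points_on_line:
  fixes k :: "'k::field^3"
  assumes "k \<noteq> 0"
  obtains p q where "cross p q \<noteq> 0" "scalar_product k p = 0" "scalar_product k q = 0"
proof -
  consider "k$1 \<noteq> 0" | "k$2 \<noteq> 0" | "k$3 \<noteq> 0" using assms by (auto simp: vec3_eq_iff)
  then show ?thesis
  proof cases
    case 1 then show ?thesis
      by (intro that[of "vector [k$2, -k$1, 0]" "vector [k$3, 0, -k$1]"])
        (auto simp: cross_def vec3_eq_iff scalar_product_3)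
  next
    case 2 then show ?thesis
      by (intro that[of "vector [k$2, -k$1, 0]" "vector [0, k$3, -k$2]"])
        (auto simp: cross_def vec3_eq_iff scalar_product_3)
  next
    case 3 then show ?thesis
      by (intro that[of "vector [k$3, 0, -k$1]" "vector [0, k$3, -k$2]"])
        (auto simp: cross_def vec3_eq_iff scalar_product_3)
  qed
qed

lemma cross_nonzero_imp:
  assumes "cross p (q::'k::field^3) \<noteq> 0"
  shows "p \<noteq> 0" "q \<noteq> 0" "p + q \<noteq> 0" "cross p (p + q) \<noteq> 0" "cross q (p + q) \<noteq> 0"
  using assms
  by (auto simp: cross_def vec3_eq_iff algebra_simps eq_neg_iff_add_eq_0[symmetric] add_eq_0_iff)

lemma line_points_eq_imp_proportional:
  fixes l m :: "'k::field^3"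
  assumes "l \<noteq> 0" "m \<noteq> 0" "line_points l = line_points m"
  obtains c where "c \<noteq> 0" "l = c *s m"
proof -
  obtain p q where pq: "cross p q \<noteq> 0" "scalar_product l p = 0" "scalar_product l q = 0"
    using two_points_on_line[OF assms(1)] by blast
  then have "p \<in> line_points m" "q \<in> line_points m"
    using assms(3) cross_nonzero_imp[OF pq(1)] by (auto simp: line_points_def)
  then show ?thesis
    using line_through_two_points[OF assms(1,2) pq(1)] pq that by (auto simp: line_points_def)
qed

text \<open>A line \<open>k\<close> contains the three pairwise different points \<open>p\<close>, \<open>q\<close>,
  \<open>p + q\<close>. Two of them lie on the same one of the two covering lines, and two points determine the
  line.\<close>

lemma line_subset_union:
  fixes k l m :: "'k::field^3"
  assumes nz: "k \<noteq> 0" "l \<noteq> 0" "m \<noteq> 0" and sub: "line_points k \<subseteq> line_points l \<union> line_points m"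
  shows "line_points k = line_points l \<or> line_points k = line_points m"
proof -
  obtain p q where pq: "cross p q \<noteq> 0" "scalar_product k p = 0" "scalar_product k q = 0"
    using two_points_on_line[OF nz(1)] by blast
  note c = cross_nonzero_imp[OF pq(1)]
  have kr: "scalar_product k (p + q) = 0"
    using pq by (simp add: scalar_product_add_right)
  have *: "line_points k = line_points n"
    if "n \<noteq> 0" "cross u v \<noteq> 0" "scalar_product k u = 0" "scalar_product k v = 0" "scalar_product n u = 0" "scalar_product n v = 0" for n u v
    using line_through_two_points[OF nz(1) that(1,2) that(3-6)] line_points_scale by metis
  have "x \<in> line_points l \<union> line_points m" if "x \<in> {p, q, p + q}" for x
    using that sub pq kr c by (auto simp: line_points_def)
  then have **: "scalar_product l x = 0 \<or> scalar_product m x = 0" if "x \<in> {p, q, p + q}" for x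
    using that by (fastforce simp: line_points_def)
  from **[of p] **[of q] **[of "p + q"] show ?thesis
    using *[OF nz(2) pq(1)] *[OF nz(2) c(4)] *[OF nz(2) c(5)] *[OF nz(3) pq(1)] *[OF nz(3) c(4)] *[OF nz(3) c(5)]
      pq kr by auto
qed

lemma point_off_two_lines:
  fixes l m :: "'k::field^3"
  assumes "l \<noteq> 0" "m \<noteq> 0"
  obtains v where "scalar_product l v \<noteq> 0" "scalar_product m v \<noteq> 0"
proof -
  have ex: "\<exists>v. scalar_product n v \<noteq> 0" if "n \<noteq> 0" for n :: "'k^3"
  proof -
    obtain i where "n $ i \<noteq> 0" using \<open>n \<noteq> 0\<close> by (auto simp: vec_eq_iff)
    then have "scalar_product n (axis i 1) \<noteq> 0"
      by (simp add: scalar_product_def axis_def if_distrib cong: if_cong)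
    then show ?thesis ..
  qed
  obtain v w where v: "scalar_product l v \<noteq> 0" and w: "scalar_product m w \<noteq> 0"
    using ex assms by metis
  show ?thesis
  proof (cases "scalar_product m v = 0 \<and> scalar_product l w = 0")
    case True
    then show ?thesis using v w that[of "v + w"] by (simp add: scalar_product_add_right)
  next
    case False
    then show ?thesis using v w that by blast
  qed
qed

section \<open>Tangent lines\<close>

text \<open>The maps \<open>p \<mapsto> B p\<close> and \<open>l \<mapsto> adjugate3 B l\<close> exchange points and
  their polar lines, and a point lies on the conic exactly when its polar line lies on the dual conic.\<close>

lemma tangent_line_iff:
  fixes B :: "'k::field^3^3"
  assumes sym: "transpose B = B" and B: "det B \<noteq> 0" and l: "l \<noteq> 0"
  shows "tangent_line l B \<longleftrightarrow> dual_form B l l = 0"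
proof
  assume "tangent_line l B"
  then obtain p where p: "p \<noteq> 0" "scalar_product p (B *v p) = 0" "line_points l = line_points (B *v p)"
    by (auto simp: tangent_line_def conic_points_def)
  have "B *v p \<noteq> 0"
  proof
    assume "B *v p = 0"
    then have "det B *s p = 0" using adjugate3_mult[of B p] by simp
    then show False using B p(1) by (simp add: vec_eq_iff)
  qed
  then obtain c where c: "l = c *s (B *v p)"
    using line_points_eq_imp_proportional[OF l _ p(3)] by blast
  have "adjugate3 B *v l = (c * det B) *s p"
    by (simp only: c matrix_vector_mult_scaleR vector_scalar_commute adjugate3_mult vector_smult_assoc)
  then have "dual_form B l l = c * det B * scalar_product l p"
    by (simp add: dual_form_def scalar_product_scale_right)
  also have "scalar_product l p = c * scalar_product p (B *v p)"
    by (simp only: c scalar_product_commute[of _ p] scalar_product_scale_right)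
  finally show "dual_form B l l = 0" using p by simp
next
  assume d: "dual_form B l l = 0"
  define p where "p = adjugate3 B *v l"
  have Bp: "B *v p = det B *s l" unfolding p_def by (rule mult_adjugate3)
  have "p \<noteq> 0"
  proof
    assume "p = 0"
    then have "det B *s l = 0" using Bp by simp
    then show False using B l by (simp add: vec_eq_iff)
  qed
  moreover have "scalar_product p (B *v p) = 0"
    unfolding Bp scalar_product_scale_right scalar_product_commute[of p l]
    using d by (simp add: dual_form_def p_def)
  moreover have "line_points l = line_points (B *v p)"
    by (simp add: Bp line_points_scale B)
  ultimately show "tangent_line l B"
    by (auto simp: tangent_line_def conic_points_def)
qed

lemma conic_points_line_pair:
  assumes "(2::'k::field) \<noteq> 0" and "l \<noteq> 0" "m \<noteq> 0"
  shows "conic_points (line_pair l m :: 'k^3^3) = line_points l \<union> line_points m"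
proof -
  have "scalar_product v (line_pair l m *v v) = 2 * scalar_product l v * scalar_product m v" for v
    by (simp add: scalar_product_3 line_pair_def matrix_vector_mult_def sum_3 algebra_simps)
  then show ?thesis
    using assms by (auto simp: conic_points_def line_points_def)
qed

section \<open>Singular conics over an algebraically closed field\<close>

text \<open>Let \<open>Q = a x\<^sup>2 + b y\<^sup>2 + c z\<^sup>2 + 2 f x y + 2 g x z + 2 h y z\<close>. Completing
  the square gives \<open>a Q = (a x + f y + g z)\<^sup>2 - ((f\<^sup>2 - a b) y\<^sup>2 + 2 (f g - a h) y z +
  (g\<^sup>2 - a c) z\<^sup>2)\<close>. The discriminant of the binary form on the right is a multiple of the
  determinant, so that form is the square of \<open>\<alpha> y + \<beta> z\<close>, and \<open>a Q\<close> is a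
  difference of two squares.\<close>

lemma singular_form_splits_aux:
  fixes a b c f g h :: "'k::alg_closed_field"
  assumes two: "(2::'k) \<noteq> 0" and a: "a \<noteq> 0"
    and det: "a*b*c + 2*f*g*h - a*h^2 - b*g^2 - c*f^2 = 0"
  obtains l1 l2 l3 m1 m2 m3 where
    "2*l1*m1 = a" "2*l2*m2 = b" "2*l3*m3 = c"
    "l1*m2 + m1*l2 = f" "l1*m3 + m1*l3 = g" "l2*m3 + m2*l3 = h"
proof -
  obtain \<alpha> where \<alpha>: "\<alpha>^2 = f^2 - a*b"
    using nth_root_exists[of 2 "f^2 - a*b"] by auto
  obtain \<beta>0 where \<beta>0: "\<beta>0^2 = g^2 - a*c"
    using nth_root_exists[of 2 "g^2 - a*c"] by auto
  have "(\<alpha> * \<beta>0)^2 - (f*g - a*h)^2 = a * (a*b*c + 2*f*g*h - a*h^2 - b*g^2 - c*f^2)"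
    by (simp only: power_mult_distrib \<alpha> \<beta>0) (simp add: algebra_simps power2_eq_square)
  then have "(\<alpha> * \<beta>0)^2 = (f*g - a*h)^2"
    using det by simp
  then have "\<alpha> * \<beta>0 = f*g - a*h \<or> \<alpha> * \<beta>0 = - (f*g - a*h)"
    by (simp only: power2_eq_iff)
  then obtain \<beta> where \<beta>: "\<beta>^2 = g^2 - a*c" and \<alpha>\<beta>: "\<alpha> * \<beta> = f*g - a*h"
  proof
    assume "\<alpha> * \<beta>0 = - (f*g - a*h)"
    then have "\<alpha> * - \<beta>0 = f*g - a*h"
      by simp
    then show ?thesis using \<beta>0 that[of "-\<beta>0"] by simp
  qed (use \<beta>0 that in blast)
  have product: "2*(x+y)*((x-y)/(2*a)) = (x^2 - y^2)/a" for x y :: 'k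
    using two a by (simp add: field_simps power2_eq_square)
  have "2*(f+\<alpha>)*((f-\<alpha>)/(2*a)) = b"
    unfolding product \<alpha> using a by simp
  moreover have "2*(g+\<beta>)*((g-\<beta>)/(2*a)) = c"
    unfolding product \<beta> using a by simp
  moreover have "(f+\<alpha>)*((g-\<beta>)/(2*a)) + ((f-\<alpha>)/(2*a))*(g+\<beta>) = h"
  proof -
    have "(f+\<alpha>)*((g-\<beta>)/(2*a)) + ((f-\<alpha>)/(2*a))*(g+\<beta>) = (2*(f*g) - 2*(\<alpha>*\<beta>))/(2*a)"
      by (simp add: add_divide_distrib[symmetric] algebra_simps)
    also have "\<dots> = h"
      unfolding \<alpha>\<beta> using two a by (simp add: field_simps)
    finally show ?thesis .
  qed
  moreover have "a*((x-y)/(2*a)) + (1/2)*(x+y) = x" for x y :: 'k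
  proof -
    have "a*((x-y)/(2*a)) = (x-y)/2"
      using a by simp
    then have "a*((x-y)/(2*a)) + (1/2)*(x+y) = ((x-y) + (x+y)) / 2"
      by (simp only: add_divide_distrib) (simp add: add_divide_distrib)
    also have "\<dots> = x"
      using two by (simp add: mult_2[symmetric])
    finally show ?thesis .
  qed
  moreover have "2*a*(1/2) = a"
    using two by simp
  ultimately show ?thesis
    by (intro that[of a "1/2" "f+\<alpha>" "(f-\<alpha>)/(2*a)" "g+\<beta>" "(g-\<beta>)/(2*a)"])
qed

lemma line_pair_eqI:
  fixes A :: "'k::field^3^3"
  assumes "transpose A = A"
    "2*l1*m1 = A$1$1" "2*l2*m2 = A$2$2" "2*l3*m3 = A$3$3"
    "l1*m2 + m1*l2 = A$1$2" "l1*m3 + m1*l3 = A$1$3" "l2*m3 + m2*l3 = A$2$3"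
  shows "A = line_pair (vector [l1, l2, l3]) (vector [m1, m2, m3])"
  unfolding vec3_eq_iff line_pair_def
  using assms(2-) symmetric3[OF assms(1)] by (simp add: algebra_simps)

text \<open>Over an algebraically closed field every singular conic is a pair of lines (possibly equal, or with a zero
  vector in place of a line if \<open>A = 0\<close>). If some diagonal entry is nonzero, the coordinates are permuted
  so that it comes first; if all vanish, the determinant is \<open>2 f g h\<close>, and the form has a coordinate as a
  factor.\<close>

lemma singular_imp_line_pair:
  fixes A :: "'k::alg_closed_field^3^3"
  assumes two: "(2::'k) \<noteq> 0" and sym: "transpose A = A" and det: "det A = 0"
  obtains l m where "A = line_pair l m"
proof -
  note s = symmetric3[OF sym]
  define a where "a = A$1$1" define b where "b = A$2$2" define c where "c = A$3$3"
  define f where "f = A$1$2" define g where "g = A$1$3" define h where "h = A$2$3"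
  note defs = a_def b_def c_def f_def g_def h_def
  have d: "a*b*c + 2*f*g*h - a*h^2 - b*g^2 - c*f^2 = 0"
    using det by (simp add: det_3 s defs power2_eq_square algebra_simps)
  have d': "b*a*c + 2*f*h*g - b*g^2 - a*h^2 - c*f^2 = 0" "c*b*a + 2*h*g*f - c*f^2 - b*g^2 - a*h^2 = 0"
    using d by (simp_all add: algebra_simps)
  note I = line_pair_eqI[OF sym, folded defs]
  consider "a \<noteq> 0" | "b \<noteq> 0" | "c \<noteq> 0" | "a = 0" "b = 0" "c = 0" by blast
  then show ?thesis
  proof cases
    case 1
    obtain l1 l2 l3 m1 m2 m3 where
      "2*l1*m1 = a" "2*l2*m2 = b" "2*l3*m3 = c"
      "l1*m2 + m1*l2 = f" "l1*m3 + m1*l3 = g" "l2*m3 + m2*l3 = h"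
      by (rule singular_form_splits_aux[OF two 1 d])
    then show ?thesis by (intro that[OF I[of l1 m1 l2 m2 l3 m3]])
  next
    case 2
    obtain l1 l2 l3 m1 m2 m3 where
      "2*l2*m2 = b" "2*l1*m1 = a" "2*l3*m3 = c"
      "l2*m1 + m2*l1 = f" "l2*m3 + m2*l3 = h" "l1*m3 + m1*l3 = g"
      by (rule singular_form_splits_aux[OF two 2 d'(1)])
    then show ?thesis by (intro that[OF I[of l1 m1 l2 m2 l3 m3]]) (simp_all add: algebra_simps)
  next
    case 3
    obtain l1 l2 l3 m1 m2 m3 where
      "2*l3*m3 = c" "2*l2*m2 = b" "2*l1*m1 = a"
      "l3*m2 + m3*l2 = h" "l3*m1 + m3*l1 = g" "l2*m1 + m2*l1 = f"
      by (rule singular_form_splits_aux[OF two 3 d'(2)])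
    then show ?thesis by (intro that[OF I[of l1 m1 l2 m2 l3 m3]]) (simp_all add: algebra_simps)
  next
    case 4
    then have "f = 0 \<or> g = 0 \<or> h = 0" using d two by simp
    then show ?thesis
      using that[OF I, of 0 g 0 h 1 0] that[OF I, of 0 f 1 0 0 h] that[OF I, of 1 0 0 f 0 g] 4
      by auto
  qed
qed

section \<open>Cayley's criterion\<close>

text \<open>If \<open>det (t A + B) = d (1 + x\<^sub>1 t) (1 + x\<^sub>2 t) (1 + x\<^sub>3 t)\<close>, then this is
  \<open>- d\<^sup>3\<close> times the product of the three expressions \<open>x\<^sub>i + x\<^sub>j -
  x\<^sub>k\<close>.\<close>

definition cayley4 :: "'a::comm_ring_1^3^3 \<Rightarrow> 'a^3^3 \<Rightarrow> 'a" where
  "cayley4 A B = mixed_det A B ^ 3 - 4 * det B * mixed_det A B * mixed_det B A + 8 * (det B)\<^sup>2 * det A"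

text \<open>The roots of \<open>det (t A + B)\<close> turn the Cayley condition into a statement about singular
  members. Some \<open>x\<^sub>i\<close> equals the sum of the other two exactly when it is half of \<open>x\<^sub>1 +
  x\<^sub>2 + x\<^sub>3 = mixed_det A B / det B\<close>, that is, when \<open>t = - 2 det B / mixed_det A B\<close> is
  a root. In the homogeneous form given here it also covers the case \<open>mixed_det A B = 0\<close>.\<close>

lemma det_comb_cayley4:
  "det (comb (- 2 * det B) A (mixed_det A B) B) = - det B * cayley4 A B"
  unfolding det_comb cayley4_def by (simp add: algebra_simps power2_eq_square power3_eq_cube)

lemma det_to_closure: "det (to_closure A) = to_ac (det (A::'a::field^3^3))"
  by (simp add: det_3 map_matrix_def)

lemma mixed_det_to_closure: "mixed_det (to_closure A) (to_closure B) = to_ac (mixed_det A (B::'a::field^3^3))"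
  by (simp add: mixed_det_expand det_3 map_matrix_def)

lemma transpose_to_closure: "transpose A = A \<Longrightarrow> transpose (to_closure A) = to_closure A"
  by (simp add: vec_eq_iff transpose_def map_matrix_def)

lemma cayley4_to_closure: "cayley4 (to_closure A) (to_closure B) = to_ac (cayley4 A (B::'a::field^3^3))"
  by (simp add: cayley4_def det_to_closure mixed_det_to_closure)

lemma pencil_det_eq:
  "pencil_det A B = fps_const (det B) + fps_const (mixed_det A B) * fps_X
     + fps_const (mixed_det B A) * fps_X^2 + fps_const (det A) * fps_X^3"
proof -
  define A' :: "'a fps^3^3" where "A' = (\<chi> i j. fps_const (A $ i $ j))"
  define B' :: "'a fps^3^3" where "B' = (\<chi> i j. fps_const (B $ i $ j))"
  have "pencil_det A B = det (comb fps_X A' 1 B')"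
    unfolding pencil_det_def comb_def A'_def B'_def by simp
  also have "\<dots> = det B' + mixed_det A' B' * fps_X + mixed_det B' A' * fps_X^2 + det A' * fps_X^3"
    unfolding det_comb by (simp add: algebra_simps)
  moreover have "det A' = fps_const (det A)" "det B' = fps_const (det B)"
    "mixed_det A' B' = fps_const (mixed_det A B)" "mixed_det B' A' = fps_const (mixed_det B A)"
    unfolding mixed_det_expand det_3 A'_def B'_def by simp_all
  ultimately show ?thesis by simp
qed

text \<open>Solving \<open>H\<^sup>2 = D\<close> coefficient by coefficient, starting from a square root
  \<open>r\<close> of the constant term. At step \<open>n\<close> the unknown enters linearly, with factor \<open>2
  r\<close>.\<close>

fun fps_sqrt_coeff :: "'k::field \<Rightarrow> 'k fps \<Rightarrow> nat \<Rightarrow> 'k" where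
  "fps_sqrt_coeff r D n = (if n = 0 then r else
     (fps_nth D n - (\<Sum>i\<in>{1..<n}. fps_sqrt_coeff r D i * fps_sqrt_coeff r D (n - i))) / (2 * r))"

declare fps_sqrt_coeff.simps [simp del]

lemma fps_sqrt_exists:
  fixes D :: "'k::alg_closed_field fps"
  assumes two: "(2::'k) \<noteq> 0" and D: "fps_nth D 0 \<noteq> 0"
  obtains H where "H^2 = D"
proof -
  obtain r where r: "r^2 = fps_nth D 0"
    using nth_root_exists[of 2 "fps_nth D 0"] by auto
  with D have "r \<noteq> 0" by auto
  define H where "H = Abs_fps (fps_sqrt_coeff r D)"
  have "fps_nth (H^2) n = fps_nth D n" for n
  proof (cases n)
    case 0
    then show ?thesis
      using r by (simp add: H_def power2_eq_square fps_sqrt_coeff.simps[of r D 0])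
  next
    case (Suc k)
    have "{0..n} = insert 0 (insert n {1..<n})"
      using Suc by auto
    then have "fps_nth (H^2) n = 2 * r * fps_sqrt_coeff r D n +
        (\<Sum>i\<in>{1..<n}. fps_sqrt_coeff r D i * fps_sqrt_coeff r D (n - i))"
      using Suc by (simp add: power2_eq_square fps_mult_nth H_def fps_sqrt_coeff.simps[of r D 0])
    also have "2 * r * fps_sqrt_coeff r D n =
       fps_nth D n - (\<Sum>i\<in>{1..<n}. fps_sqrt_coeff r D i * fps_sqrt_coeff r D (n - i))"
      using Suc two \<open>r \<noteq> 0\<close> by (subst fps_sqrt_coeff.simps) simp
    finally show ?thesis by simp
  qed
  then show ?thesis using that[of H] by (simp add: fps_eq_iff)
qed

lemma two_neq_0_closure: "(2::'a::field) \<noteq> 0 \<Longrightarrow> (2::'a alg_closure) \<noteq> 0"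
  using to_ac_eq_0_iff[of "2::'a"] by simp

text \<open>Comparing the coefficients of \<open>H\<^sup>2\<close> with those of \<open>det (t A + B)\<close> up to
  degree 3 gives \<open>cayley4 A B = 16 H\<^sub>0\<^sup>5 H\<^sub>3\<close>. The condition no longer mentions the
  algebraic closure.\<close>

lemma poncelet4_pair_iff:
  fixes A B :: "'a::field^3^3"
  assumes two: "(2::'a) \<noteq> 0" and B: "det B \<noteq> 0"
  shows "poncelet4_pair A B \<longleftrightarrow> cayley4 A B = 0"
proof -
  let ?A = "to_closure A" and ?B = "to_closure B"
  note two' = two_neq_0_closure[OF two]
  have B': "det ?B \<noteq> 0" using B by (simp add: det_to_closure)
  have key: "fps_nth H 3 = 0 \<longleftrightarrow> cayley4 ?A ?B = 0" if "H^2 = pencil_det ?A ?B" for H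
  proof -
    have nth: "fps_nth (H * H) n = fps_nth (pencil_det ?A ?B) n" for n
      using that by (simp add: power2_eq_square)
    define h where "h = fps_nth H"
    have d: "det ?B = h 0 * h 0" "mixed_det ?A ?B = 2 * h 0 * h 1"
      "mixed_det ?B ?A = 2 * h 0 * h 2 + h 1 * h 1" "det ?A = 2 * h 0 * h 3 + 2 * h 1 * h 2"
      using nth[of 0] nth[of 1] nth[of 2] nth[of 3]
      by (simp_all add: pencil_det_eq fps_mult_nth h_def numeral_2_eq_2 numeral_3_eq_3 algebra_simps)
    have "cayley4 ?A ?B = 16 * (h 0 * h 0 * h 0 * h 0 * h 0 * h 3)"
      unfolding cayley4_def d by (simp add: algebra_simps power2_eq_square power3_eq_cube)
    moreover have "h 0 \<noteq> 0" using d(1) B' by auto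
    moreover have "(16::'a alg_closure) \<noteq> 0"
      using two' power_eq_0_iff[of "2::'a alg_closure" 4] by simp
    ultimately show ?thesis by (simp add: h_def)
  qed
  have "fps_nth (pencil_det ?A ?B) 0 \<noteq> 0"
    using B' by (simp add: pencil_det_eq)
  then obtain H where "H^2 = pencil_det ?A ?B"
    using fps_sqrt_exists[OF two'] by blast
  then have "poncelet4_pair A B \<longleftrightarrow> cayley4 ?A ?B = 0"
    unfolding poncelet4_pair_def using key by blast
  then show ?thesis by (simp add: cayley4_to_closure)
qed

text \<open>If \<open>A = k B\<close>, all three \<open>x\<^sub>i\<close> are equal to \<open>k\<close>, and no
  nonzero \<open>k\<close> is the sum of two copies of itself.\<close>

lemma not_same_conic_if_cayley4_eq_0:
  fixes A B :: "'a::field^3^3"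
  assumes B: "det B \<noteq> 0" and c: "cayley4 A B = 0"
  shows "\<not> same_conic A B"
proof
  assume "same_conic A B"
  then obtain k where k: "k \<noteq> 0" and A: "A = comb k B 0 B"
    by (auto simp: same_conic_def comb_def map_matrix_def)
  have "cayley4 A B = - ((k * det B) ^ 3)"
    unfolding cayley4_def A mixed_det_comb_left mixed_det_comb_right mixed_det_self det_comb
    by (simp add: algebra_simps power2_eq_square power3_eq_cube)
  then show False using k B c by simp
qed

lemma tangent_line_cong: "line_points l = line_points m \<Longrightarrow> tangent_line l B = tangent_line m B"
  by (simp add: tangent_line_def)

section \<open>Valid pairs with a singular first conic\<close>

text \<open>For singular \<open>A\<close> the Cayley condition says that the linear coefficient \<open>mixed_det A
  B\<close> of the quadratic polynomial \<open>det (t A + B)\<close> vanishes or that its discriminant does. By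
  \<open>discriminant_line_pair\<close> the second case is the tangent one. If the linear coefficient vanishes and the
  discriminant does not, then the leading coefficient is nonzero, which makes the two lines distinct.\<close>

lemma valid_pair_singular_iff:
  fixes A B :: "'a::field^3^3"
  assumes two: "(2::'a) \<noteq> 0" and symA: "transpose A = A" and symB: "transpose B = B"
    and A: "det A = 0" and B: "det B \<noteq> 0" and c: "cayley4 A B = 0"
  shows "valid_pair A B \<longleftrightarrow> mixed_det A B = 0 \<and> mixed_det B A \<noteq> 0"
proof -
  let ?A = "to_closure A" and ?B = "to_closure B"
  note two' = two_neq_0_closure[OF two]
  have four': "(4::'a alg_closure) \<noteq> 0"
    using two' power_eq_0_iff[of "2::'a alg_closure" 2] by simp
  have B': "det ?B \<noteq> 0" and A': "det ?A = 0" using A B by (simp_all add: det_to_closure)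
  note symA' = transpose_to_closure[OF symA] and symB' = transpose_to_closure[OF symB]
  obtain l m where lm: "?A = line_pair l m"
    using singular_imp_line_pair[OF two' symA' A'] .
  note disc = discriminant_line_pair[OF symB', of l m, folded lm, unfolded mixed_det_to_closure]
  have valid: "valid_pair A B \<longleftrightarrow> (\<exists>l m. l \<noteq> 0 \<and> m \<noteq> 0 \<and> line_points l \<noteq> line_points m \<and>
         conic_points ?A = line_points l \<union> line_points m \<and>
         \<not> tangent_line l ?B \<and> \<not> tangent_line m ?B)"
    using not_same_conic_if_cayley4_eq_0[OF B c] A B
    by (simp add: valid_pair_def smooth_conic_def invertible_det_nz)
  show ?thesis
  proof
    assume "valid_pair A B"
    then obtain l0 m0 where lm0: "l0 \<noteq> 0" "m0 \<noteq> 0"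
      "conic_points ?A = line_points l0 \<union> line_points m0"
      "\<not> tangent_line l0 ?B" "\<not> tangent_line m0 ?B"
      using valid by auto
    \<comment> \<open>Otherwise \<open>A = 0\<close>, and the two lines would cover the whole plane.\<close>
    have nz: "l \<noteq> 0 \<and> m \<noteq> 0"
    proof (rule ccontr)
      assume "\<not> ?thesis"
      then have zero: "?A = 0" by (auto simp: lm line_pair_def vec_eq_iff)
      obtain v where "scalar_product l0 v \<noteq> 0" "scalar_product m0 v \<noteq> 0"
        using point_off_two_lines[OF lm0(1,2)] .
      moreover from this have "v \<noteq> 0" by (auto simp: scalar_product_def)
      then have "v \<in> conic_points ?A"
        unfolding zero conic_points_def by (simp add: scalar_product_def)
      ultimately show False using lm0(3) by (auto simp: line_points_def)
    qed
    then have "line_points l \<union> line_points m = line_points l0 \<union> line_points m0"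
      using lm0(3) conic_points_line_pair[OF two'] lm by metis
    then have "line_points l = line_points l0 \<or> line_points l = line_points m0"
      "line_points m = line_points l0 \<or> line_points m = line_points m0"
      using line_subset_union lm0(1,2) nz by blast+
    then have "\<not> tangent_line l ?B" "\<not> tangent_line m ?B"
      using lm0 tangent_line_cong by metis+
    then have "dual_form ?B l l \<noteq> 0" "dual_form ?B m m \<noteq> 0"
      using tangent_line_iff[OF symB' B'] nz by blast+
    then have "to_ac ((mixed_det A B)\<^sup>2 - 4 * det B * mixed_det B A) \<noteq> 0"
      using disc four' by (simp add: det_to_closure)
    then have *: "(mixed_det A B)\<^sup>2 - 4 * det B * mixed_det B A \<noteq> 0"
      unfolding to_ac_eq_0_iff .
    have "mixed_det A B * ((mixed_det A B)\<^sup>2 - 4 * det B * mixed_det B A) = 0"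
      using c A by (simp add: cayley4_def algebra_simps power2_eq_square power3_eq_cube)
    then show "mixed_det A B = 0 \<and> mixed_det B A \<noteq> 0"
      using * by auto
  next
    assume d: "mixed_det A B = 0 \<and> mixed_det B A \<noteq> 0"
    have "cross l m \<noteq> 0"
    proof
      assume "cross l m = 0"
      then have "mixed_det ?B ?A = 0"
        by (simp add: lm mixed_det_line_pair_right[OF symB'] scalar_product_def)
      then show False using d by (simp add: mixed_det_to_closure)
    qed
    then have nz: "l \<noteq> 0" "m \<noteq> 0"
      using cross_nonzero_imp by blast+
    have "line_points l \<noteq> line_points m"
    proof
      assume "line_points l = line_points m"
      then obtain k where "l = k *s m"
        using line_points_eq_imp_proportional nz by metis
      then have "cross l m = 0" by (simp add: cross_def vec3_eq_iff)
      then show False using \<open>cross l m \<noteq> 0\<close> by simp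
    qed
    moreover have "dual_form ?B l l \<noteq> 0" "dual_form ?B m m \<noteq> 0"
      using disc d four' B by (auto simp: det_to_closure)
    then have "\<not> tangent_line l ?B" "\<not> tangent_line m ?B"
      using tangent_line_iff[OF symB' B'] nz by blast+
    ultimately show "valid_pair A B"
      unfolding valid using nz conic_points_line_pair[OF two' nz, folded lm] by blast
  qed
qed

section \<open>Counting Poncelet pairs in a pencil\<close>

lemma comb_comb_comb:
  "comb x (comb u A v B) y (comb u' A v' B) = comb (x * u + y * u') A (x * v + y * v') B"
  by (simp add: comb_def vec_eq_iff algebra_simps)

text \<open>Homogeneous coordinates on the projective line, the choice that makes \<open>pencil_conic (A, B) r\<close>
  the combination of \<open>A\<close> and \<open>B\<close> with coefficients \<open>proj_coords r\<close>.\<close>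

fun proj_coords :: "'a::field option \<Rightarrow> 'a \<times> 'a" where
  "proj_coords None = (1, 0)"
| "proj_coords (Some t) = (t, 1)"

definition proj_point :: "'a::field \<Rightarrow> 'a \<Rightarrow> 'a option" where
  "proj_point x y = (if y = 0 then None else Some (x / y))"

lemma pencil_conic_eq_comb:
  "pencil_conic (A, B) r = comb (fst (proj_coords r)) A (snd (proj_coords r)) B"
  by (cases r) (simp_all add: comb_def map_matrix_def vec_eq_iff)

lemma pencil_conic_proj_point:
  assumes "(x, y) \<noteq> (0, 0)"
  obtains k where "k \<noteq> 0" "comb x A y B = comb k (pencil_conic (A, B) (proj_point x y)) 0 B"
proof (cases "y = 0")
  case True
  then show ?thesis
    using assms that[of x] by (simp add: proj_point_def comb_def)
next
  case False
  then show ?thesis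
    using that[of y] by (simp add: proj_point_def comb_def map_matrix_def vec_eq_iff field_simps)
qed

lemma det_pencil_conic_proj_point:
  assumes "(x, y) \<noteq> (0, 0)"
  shows "det (pencil_conic (A, B) (proj_point x y)) = 0 \<longleftrightarrow> det (comb x A y B) = 0"
  by (rule pencil_conic_proj_point[OF assms, of A B]) (simp add: det_comb)

declare pencil_conic.simps [simp del]

lemma proj_point_eq_imp:
  assumes "(x, y) \<noteq> (0, 0)" "(x', y') \<noteq> (0, 0)" "proj_point x y = proj_point x' y'"
  shows "x * y' = x' * y"
  using assms by (auto simp: proj_point_def field_simps split: if_splits)

lemma proj_coords_cross_eq_0:
  "fst (proj_coords r) * snd (proj_coords r') = fst (proj_coords r') * snd (proj_coords r) \<longleftrightarrow> r = r'"
  by (cases r; cases r') auto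

locale symmetric_pencil =
  fixes A B :: "'a::{field,finite}^3^3"
  assumes two: "(2::'a) \<noteq> 0" and symA: "transpose A = A" and symB: "transpose B = B"
begin

abbreviation conic :: "'a option \<Rightarrow> 'a^3^3" where
  "conic r \<equiv> pencil_conic (A, B) r"

lemma transpose_conic: "transpose (conic r) = conic r"
  unfolding pencil_conic_eq_comb comb_def vec_eq_iff transpose_def
  using symA symB by (simp add: transpose_def vec_eq_iff)

definition singular_params :: "'a option set" where
  "singular_params = {r. det (conic r) = 0}"

definition poncelet_params :: "('a option \<times> 'a option) set" where
  "poncelet_params = {(r, s). s \<notin> singular_params \<and> cayley4 (conic r) (conic s) = 0}"

text \<open>For a smooth member \<open>s\<close>, the parameter of the member \<open>(mixed_det C D) D - (2 det D)
  C\<close> of the pencil, where \<open>C\<close> and \<open>D\<close> are the members \<open>r\<close> and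
  \<open>s\<close>. By \<open>det_comb_cayley4\<close>, the pair \<open>(r, s)\<close> satisfies the Cayley condition
  exactly when that member is singular.\<close>

definition opposite_param :: "'a option \<Rightarrow> 'a option \<Rightarrow> 'a option" where
  "opposite_param s r =
    (let d1 = mixed_det (conic r) (conic s); d0 = det (conic s) in
     proj_point (d1 * fst (proj_coords s) - 2 * d0 * fst (proj_coords r))
                (d1 * snd (proj_coords s) - 2 * d0 * snd (proj_coords r)))"

text \<open>Since \<open>mixed_det C D\<close> is linear in \<open>C\<close>, the map on homogeneous coordinates is
  linear in those of \<open>r\<close>. It multiplies \<open>s\<close> by \<open>3 d\<^sub>0 - 2 d\<^sub>0 =
  d\<^sub>0\<close> and acts as \<open>- 2 d\<^sub>0\<close> modulo \<open>s\<close>, where \<open>d\<^sub>0 = det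
  D\<close>. Its determinant is therefore \<open>- 2 d\<^sub>0\<^sup>2 \<noteq> 0\<close>, and it induces a bijection
  of the projective line.\<close>

lemma
  assumes s: "s \<notin> singular_params"
  shows inj_opposite_param: "inj (opposite_param s)"
    and opposite_param_singular_iff:
      "opposite_param s r \<in> singular_params \<longleftrightarrow> cayley4 (conic r) (conic s) = 0"
proof -
  define u where "u = (\<lambda>r. fst (proj_coords (r::'a option)))"
  define v where "v = (\<lambda>r. snd (proj_coords (r::'a option)))"
  define d0 where "d0 = det (conic s)"
  define d1 where "d1 = (\<lambda>r. mixed_det (conic r) (conic s))"
  define x where "x = (\<lambda>r. d1 r * u s - 2 * d0 * u r)"
  define y where "y = (\<lambda>r. d1 r * v s - 2 * d0 * v r)"
  note defs = u_def v_def d0_def d1_def x_def y_def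
  have opp: "opposite_param s r = proj_point (x r) (y r)" for r
    by (simp add: opposite_param_def Let_def defs)
  have d0: "d0 \<noteq> 0" using s by (simp add: singular_params_def d0_def)
  define a where "a = mixed_det A (conic s)"
  define b where "b = mixed_det B (conic s)"
  have d1: "d1 r = u r * a + v r * b" for r
    by (simp add: d1_def pencil_conic_eq_comb[of A B r] mixed_det_comb_left a_def b_def defs)
  have "d1 s = 3 * d0"
    by (simp add: d1_def d0_def mixed_det_self)
  then have d0_3: "3 * d0 = u s * a + v s * b"
    by (simp add: d1)
  have cross: "x r * y r' - x r' * y r = - 2 * d0\<^sup>2 * (u r * v r' - u r' * v r)" for r r'
  proof -
    have "x r * y r' - x r' * y r =
       - 2 * d0 * ((u s * a + v s * b) * (u r * v r' - u r' * v r)) + 4 * d0\<^sup>2 * (u r * v r' - u r' * v r)"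
      unfolding x_def y_def d1 by (simp add: algebra_simps power2_eq_square)
    also have "\<dots> = - 2 * d0\<^sup>2 * (u r * v r' - u r' * v r)"
      unfolding d0_3[symmetric] by (simp add: algebra_simps power2_eq_square)
    finally show ?thesis .
  qed
  have cross_0: "r = r'" if "x r * y r' = x r' * y r" for r r'
  proof -
    have "- 2 * d0\<^sup>2 * (u r * v r' - u r' * v r) = 0"
      unfolding cross[symmetric] using that by simp
    then have "u r * v r' = u r' * v r"
      using two d0 by simp
    then show ?thesis
      unfolding u_def v_def proj_coords_cross_eq_0 .
  qed
  have nz: "(x r, y r) \<noteq> (0, 0)" for r
  proof
    assume "(x r, y r) = (0, 0)"
    then have "r = None" "r = Some 0"
      using cross_0[of r] by auto
    then show False by simp
  qed
  show "inj (opposite_param s)"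
    by (rule injI) (simp only: opp, rule cross_0[OF proj_point_eq_imp[OF nz nz]])
  have "comb (x r) A (y r) B = comb (- 2 * d0) (conic r) (d1 r) (conic s)"
    unfolding pencil_conic_eq_comb comb_comb_comb by (simp add: x_def y_def u_def v_def)
  then have "det (comb (x r) A (y r) B) = - d0 * cayley4 (conic r) (conic s)"
    unfolding d0_def d1_def by (simp only: det_comb_cayley4)
  then show "opposite_param s r \<in> singular_params \<longleftrightarrow> cayley4 (conic r) (conic s) = 0"
    unfolding opp singular_params_def using det_pencil_conic_proj_point[OF nz, of A B] d0 by simp
qed

text \<open>For each smooth \<open>s\<close> the bijection \<open>opposite_param s\<close> carries the parameters
  \<open>r\<close> with the Cayley condition onto the singular parameters.\<close>

lemma card_poncelet_params:
  "card poncelet_params = card singular_params * (CARD('a) + 1 - card singular_params)"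
proof -
  have fib: "card {r. cayley4 (conic r) (conic s) = 0} = card singular_params"
    if "s \<notin> singular_params" for s
  proof -
    have inj: "inj (opposite_param s)" by (rule inj_opposite_param[OF that])
    then have "surj (opposite_param s)" by (simp add: finite_UNIV_inj_surj)
    then have "card (opposite_param s -` singular_params) = card singular_params"
      using inj by (intro card_vimage_inj) auto
    also have "opposite_param s -` singular_params = {r. cayley4 (conic r) (conic s) = 0}"
      using opposite_param_singular_iff[OF that] by auto
    finally show ?thesis .
  qed
  have "poncelet_params = prod.swap ` (SIGMA s:- singular_params. {r. cayley4 (conic r) (conic s) = 0})"
    by (auto simp: poncelet_params_def image_iff)
  then have "card poncelet_params = card (SIGMA s:- singular_params. {r. cayley4 (conic r) (conic s) = 0})"
    by (simp add: card_image)
  also have "\<dots> = (\<Sum>s\<in>- singular_params. card singular_params)"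
    by (simp add: card_SigmaI fib)
  also have "\<dots> = card (- singular_params) * card singular_params"
    by simp
  also have "card (- singular_params) = CARD('a option) - card singular_params"
    unfolding Compl_eq_Diff_UNIV by (rule card_Diff_subset) simp_all
  also have "CARD('a option) = CARD('a) + 1"
    by simp
  finally show ?thesis by (simp add: mult.commute)
qed

text \<open>The pairs in which the first conic is singular are the ones that smooth pairs exclude; the valid ones
  among them, described by \<open>valid_pair_singular_iff\<close>, have to be added back.\<close>

definition singular_poncelet_params where
  "singular_poncelet_params = {(r, s) \<in> poncelet_params. r \<in> singular_params}"

definition singular_valid_params where
  "singular_valid_params = {(r, s) \<in> singular_poncelet_params.
     mixed_det (conic r) (conic s) = 0 \<and> mixed_det (conic s) (conic r) \<noteq> 0}"

lemma M_sm_eq: "M_sm (A, B) = card poncelet_params - card singular_poncelet_params"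
proof -
  have "smooth_pair (conic r) (conic s) \<and> poncelet4_pair (conic r) (conic s) \<longleftrightarrow>
     (r, s) \<in> poncelet_params - singular_poncelet_params" for r s
    using poncelet4_pair_iff[OF two, of "conic s" "conic r"]
      not_same_conic_if_cayley4_eq_0[of "conic s" "conic r"]
    by (auto simp: smooth_pair_def poncelet_params_def singular_poncelet_params_def
       singular_params_def smooth_conic_def invertible_det_nz)
  then have "M_sm (A, B) = card (poncelet_params - singular_poncelet_params)"
    unfolding M_sm_def by (intro arg_cong[of _ _ card]) auto
  also have "\<dots> = card poncelet_params - card singular_poncelet_params"
    by (rule card_Diff_subset) (auto simp: singular_poncelet_params_def)
  finally show ?thesis .
qed

lemma M_val_eq: "M_val (A, B) = M_sm (A, B) + card singular_valid_params"
proof -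
  have "valid_pair (conic r) (conic s) \<and> poncelet4_pair (conic r) (conic s) \<longleftrightarrow>
     smooth_pair (conic r) (conic s) \<and> poncelet4_pair (conic r) (conic s) \<or>
      (r, s) \<in> singular_valid_params" for r s
  proof (cases "det (conic s) = 0")
    case True
    then show ?thesis
      by (simp add: valid_pair_def smooth_pair_def smooth_conic_def invertible_det_nz
        singular_valid_params_def singular_poncelet_params_def poncelet_params_def singular_params_def)
  next
    case s: False
    show ?thesis
    proof (cases "cayley4 (conic r) (conic s) = 0")
      case False
      then show ?thesis
        using poncelet4_pair_iff[OF two s, of "conic r"]
        by (simp add: singular_valid_params_def singular_poncelet_params_def poncelet_params_def)
    next
      case c: True
      show ?thesis
        using poncelet4_pair_iff[OF two s, of "conic r"] c s
          valid_pair_singular_iff[OF two transpose_conic transpose_conic _ s c]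
        by (cases "det (conic r) = 0")
          (auto simp: valid_pair_def smooth_pair_def smooth_conic_def invertible_det_nz
           singular_valid_params_def singular_poncelet_params_def poncelet_params_def singular_params_def)
    qed
  qed
  then have "M_val (A, B) = card ({(r, s). smooth_pair (conic r) (conic s) \<and> poncelet4_pair (conic r) (conic s)}
     \<union> singular_valid_params)"
    unfolding M_val_def by (intro arg_cong[of _ _ card]) auto
  also have "\<dots> = M_sm (A, B) + card singular_valid_params"
    unfolding M_sm_def
    by (rule card_Un_disjoint)
      (auto simp: singular_valid_params_def singular_poncelet_params_def singular_params_def
        smooth_pair_def smooth_conic_def invertible_det_nz)
  finally show ?thesis .
qed

lemma no_singular_member:
  assumes "singular_params = {}"
  shows "M_sm (A, B) = 0" "M_val (A, B) = 0"
proof -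
  have "card poncelet_params = 0" unfolding card_poncelet_params assms by simp
  then show "M_sm (A, B) = 0" by (simp add: M_sm_eq)
  have "singular_valid_params = {}"
    unfolding singular_valid_params_def singular_poncelet_params_def assms by auto
  then show "M_val (A, B) = 0"
    using \<open>M_sm (A, B) = 0\<close> by (simp add: M_val_eq)
qed

end

section \<open>Pencils whose first generator is singular\<close>

text \<open>The first generator is singular, so that every smooth member has a finite parameter, and the finite
  singular parameters are the roots of \<open>\<alpha> t\<^sup>2 + \<beta> t + \<gamma>\<close>.\<close>

locale pencil_singular_at_infinity = symmetric_pencil +
  fixes \<alpha> \<beta> \<gamma> :: 'a
  assumes det_A: "det A = 0" and mixed_BA: "mixed_det B A = \<alpha>"
    and mixed_AB: "mixed_det A B = \<beta>" and det_B: "det B = \<gamma>"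
begin

lemma det_conic [simp]:
  "det (conic None) = 0"
  "det (conic (Some t)) = \<alpha> * t^2 + \<beta> * t + \<gamma>"
  unfolding pencil_conic_eq_comb det_comb
  by (simp_all add: det_A det_B mixed_AB mixed_BA ac_simps)

lemma mixed_det_conic [simp]:
  "mixed_det (conic None) (conic (Some t)) = 2 * \<alpha> * t + \<beta>"
  "mixed_det (conic (Some t)) (conic None) = \<alpha>"
  "mixed_det (conic (Some r)) (conic (Some t)) = r * (2 * \<alpha> * t + \<beta>) + (\<alpha> * t^2 + 2 * \<beta> * t + 3 * \<gamma>)"
  unfolding pencil_conic_eq_comb mixed_det_comb_comb
  by (simp_all add: det_A det_B mixed_AB mixed_BA algebra_simps)

lemma singular_params_eq: "singular_params = insert None (Some ` {t. \<alpha> * t^2 + \<beta> * t + \<gamma> = 0})"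
proof -
  have "r \<in> singular_params \<longleftrightarrow> r \<in> insert None (Some ` {t. \<alpha> * t^2 + \<beta> * t + \<gamma> = 0})" for r
    by (cases r) (auto simp: singular_params_def)
  then show ?thesis by blast
qed

lemma singular_poncelet_params_iff:
  "(r, s) \<in> singular_poncelet_params \<longleftrightarrow> r \<in> singular_params \<and> s \<notin> singular_params \<and>
     mixed_det (conic r) (conic s) * ((mixed_det (conic r) (conic s))\<^sup>2
       - 4 * det (conic s) * mixed_det (conic s) (conic r)) = 0"
  by (auto simp: singular_poncelet_params_def poncelet_params_def cayley4_def singular_params_def
      algebra_simps power2_eq_square power3_eq_cube)

text \<open>Singular parameters \<open>\<infinity>\<close> and \<open>0\<close>. From \<open>\<infinity>\<close> the
  discriminant is that of \<open>\<alpha> t\<^sup>2\<close>, hence zero for every smooth \<open>s\<close>, and the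
  linear coefficient is not. From \<open>0\<close> neither vanishes, because the double root leaves a polynomial of
  degree 1.\<close>

lemma double_root:
  assumes "\<alpha> \<noteq> 0" "\<beta> = 0" "\<gamma> = 0"
  shows "int (M_sm (A, B)) = int CARD('a) - 1" "int (M_val (A, B)) = int CARD('a) - 1"
proof -
  have S: "singular_params = {None, Some 0}"
    using assms by (auto simp: singular_params_eq)
  have D: "(r, s) \<in> singular_poncelet_params \<longleftrightarrow> (r, s) \<in> {None} \<times> Some ` (- {0})" for r s
  proof (cases s)
    case (Some t)
    have "3 * (\<alpha> * t^2) - 2 * (\<alpha> * t^2) = \<alpha> * t^2" by simp
    then show ?thesis
      using assms two Some by (auto simp: singular_poncelet_params_iff S power2_eq_square)
  qed (simp add: singular_poncelet_params_iff S)
  then have D: "singular_poncelet_params = {None} \<times> Some ` (- {0})" by auto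
  have "(r, s) \<notin> singular_valid_params" for r s
    unfolding singular_valid_params_def D using assms two by (cases r; cases s) auto
  then have V: "singular_valid_params = {}" by auto
  have q: "card (- {0::'a}) = CARD('a) - 1" "CARD('a) \<ge> 1"
    by (simp_all add: Compl_eq_Diff_UNIV card_Diff_subset Suc_le_eq)
  show "int (M_sm (A, B)) = int CARD('a) - 1"
    unfolding M_sm_eq card_poncelet_params D S using q(2)
    by (simp add: card_cartesian_product card_image q(1) of_nat_diff)
  then show "int (M_val (A, B)) = int CARD('a) - 1"
    by (simp add: M_val_eq V)
qed

text \<open>The configuration of \<open>double_root\<close> with the roles of \<open>\<infinity>\<close> (now the
  double root) and \<open>0\<close> exchanged.\<close>

lemma simple_root:
  assumes "\<alpha> = 0" "\<beta> \<noteq> 0" "\<gamma> = 0"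
  shows "int (M_sm (A, B)) = int CARD('a) - 1" "int (M_val (A, B)) = int CARD('a) - 1"
proof -
  have S: "singular_params = {None, Some 0}"
    using assms by (auto simp: singular_params_eq)
  have D: "(r, s) \<in> singular_poncelet_params \<longleftrightarrow> (r, s) \<in> {Some 0} \<times> Some ` (- {0})" for r s
  proof (cases s)
    case (Some t)
    then show ?thesis
      using assms two by (auto simp: singular_poncelet_params_iff S power2_eq_square)
  qed (simp add: singular_poncelet_params_iff S)
  then have D: "singular_poncelet_params = {Some 0} \<times> Some ` (- {0})" by auto
  have "(r, s) \<notin> singular_valid_params" for r s
    unfolding singular_valid_params_def D using assms two by (cases r; cases s) auto
  then have V: "singular_valid_params = {}" by auto
  have q: "card (- {0::'a}) = CARD('a) - 1" "CARD('a) \<ge> 1"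
    by (simp_all add: Compl_eq_Diff_UNIV card_Diff_subset Suc_le_eq)
  show "int (M_sm (A, B)) = int CARD('a) - 1"
    unfolding M_sm_eq card_poncelet_params D S using q(2)
    by (simp add: card_cartesian_product card_image q(1) of_nat_diff)
  then show "int (M_val (A, B)) = int CARD('a) - 1"
    by (simp add: M_val_eq V)
qed

text \<open>A triple root at \<open>\<infinity>\<close>: \<open>det (t A + B)\<close> does not depend on
  \<open>t\<close>, so all Poncelet pairs have \<open>A\<close> as first conic, and they are not valid.\<close>

lemma constant_det:
  assumes "\<alpha> = 0" "\<beta> = 0" "\<gamma> \<noteq> 0"
  shows "M_sm (A, B) = 0" "M_val (A, B) = 0"
proof -
  have S: "singular_params = {None}"
    using assms by (auto simp: singular_params_eq)
  have D: "(r, s) \<in> singular_poncelet_params \<longleftrightarrow> (r, s) \<in> {None} \<times> range Some" for r s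
    using assms by (cases s) (auto simp: singular_poncelet_params_iff S)
  then have D: "singular_poncelet_params = {None} \<times> range Some" by auto
  have "(r, s) \<notin> singular_valid_params" for r s
    unfolding singular_valid_params_def D using assms by (cases r; cases s) auto
  then have V: "singular_valid_params = {}" by auto
  show "M_sm (A, B) = 0"
    unfolding M_sm_eq card_poncelet_params D S
    by (simp add: card_cartesian_product card_image)
  then show "M_val (A, B) = 0"
    by (simp add: M_val_eq V)
qed

text \<open>The only singular member is \<open>A\<close>. The discriminant is that of \<open>\<alpha> t\<^sup>2 +
  \<beta> t + \<gamma>\<close>, which is nonzero since a double root would be rational. The linear coefficient is the
  derivative of this polynomial at \<open>s\<close>, so \<open>A\<close> occurs for exactly one \<open>s\<close>, in a
  valid pair.\<close>

lemma no_finite_root: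
  assumes "\<alpha> \<noteq> 0" "\<And>t. \<alpha> * t^2 + \<beta> * t + \<gamma> \<noteq> 0"
  shows "int (M_sm (A, B)) = int CARD('a) - 1" "int (M_val (A, B)) = int CARD('a)"
proof -
  have S: "singular_params = {None}"
    using assms by (auto simp: singular_params_eq)
  have D: "(None, Some t) \<in> singular_poncelet_params \<longleftrightarrow> t = - \<beta> / (2 * \<alpha>)" for t
  proof -
    define z where "z = - \<beta> / (2 * \<alpha>)"
    have z: "2 * \<alpha> * z = - \<beta>"
      using two assms(1) by (simp add: z_def)
    have "\<beta>^2 - 4 * \<alpha> * \<gamma> \<noteq> 0"
    proof
      assume "\<beta>^2 - 4 * \<alpha> * \<gamma> = 0"
      then have "4 * \<alpha> * (\<alpha> * z^2 + \<beta> * z + \<gamma>) = 0"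
      proof -
        have "4 * \<alpha> * (\<alpha> * z^2 + \<beta> * z + \<gamma>) = (2 * \<alpha> * z)^2 + 2 * \<beta> * (2 * \<alpha> * z) + 4 * \<alpha> * \<gamma>"
          by (simp add: algebra_simps power2_eq_square)
        also have "\<dots> = - (\<beta>^2 - 4 * \<alpha> * \<gamma>)"
          unfolding z by (simp add: algebra_simps power2_eq_square)
        finally show ?thesis using \<open>\<beta>^2 - 4 * \<alpha> * \<gamma> = 0\<close> by simp
      qed
      moreover have "(4::'a) \<noteq> 0"
        using two power_eq_0_iff[of "2::'a" 2] by simp
      ultimately show False using assms by simp
    qed
    moreover have "(2 * \<alpha> * t + \<beta>)\<^sup>2 - 4 * (\<alpha> * t^2 + \<beta> * t + \<gamma>) * \<alpha> = \<beta>^2 - 4 * \<alpha> * \<gamma>"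
      by (simp add: algebra_simps power2_eq_square)
    ultimately have "(None, Some t) \<in> singular_poncelet_params \<longleftrightarrow> 2 * \<alpha> * t + \<beta> = 0"
      by (simp add: singular_poncelet_params_iff S)
    also have "\<dots> \<longleftrightarrow> 2 * \<alpha> * t = 2 * \<alpha> * z"
      by (simp add: z eq_neg_iff_add_eq_0)
    also have "\<dots> \<longleftrightarrow> t = z"
      using two assms(1) by simp
    finally show ?thesis by (simp only: z_def)
  qed
  have D: "(r, s) \<in> singular_poncelet_params \<longleftrightarrow> (r, s) = (None, Some (- \<beta> / (2 * \<alpha>)))" for r s
    using D by (cases s; cases r) (auto simp: singular_poncelet_params_iff S)
  then have D: "singular_poncelet_params = {(None, Some (- \<beta> / (2 * \<alpha>)))}" by auto
  have V: "singular_valid_params = singular_poncelet_params"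
    unfolding singular_valid_params_def D using assms two by auto
  show "int (M_sm (A, B)) = int CARD('a) - 1"
    unfolding M_sm_eq card_poncelet_params D S
    by (simp add: of_nat_diff Suc_le_eq)
  then show "int (M_val (A, B)) = int CARD('a)"
    by (simp add: M_val_eq V D)
qed

text \<open>Three simple singular parameters. Each of them is the first member of exactly one Poncelet pair, whose
  second member is its harmonic conjugate with respect to the other two: \<open>(p + p') / 2\<close> for
  \<open>\<infinity>\<close> and \<open>2 p' - p\<close> for \<open>p\<close>. These three pairs are valid.\<close>

lemma two_finite_roots:
  assumes "\<alpha> \<noteq> 0" "\<And>t. \<alpha> * t^2 + \<beta> * t + \<gamma> = \<alpha> * (t - p) * (t - p')" "p \<noteq> p'"
  shows "int (M_sm (A, B)) = 3 * (int CARD('a) - 3)" "int (M_val (A, B)) = 3 * (int CARD('a) - 2)"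
proof -
  have \<gamma>: "\<gamma> = \<alpha> * p * p'" using assms(2)[of 0] by simp
  have "\<beta> = \<alpha> * (1 - p) * (1 - p') - \<alpha> - \<gamma>"
    using assms(2)[of 1] by (simp add: algebra_simps)
  then have \<beta>: "\<beta> = - \<alpha> * (p + p')" by (simp add: \<gamma> algebra_simps)
  have S: "singular_params = {None, Some p, Some p'}"
    using assms(1) unfolding singular_params_eq assms(2) by auto
  have f': "2 * \<alpha> * t + \<beta> = \<alpha> * (2 * t - (p + p'))" for t
    by (simp add: \<beta> algebra_simps)
  have d1: "x * (2 * \<alpha> * t + \<beta>) + (\<alpha> * t^2 + 2 * \<beta> * t + 3 * \<gamma>) = \<alpha> * (t - x) * (t - (2 * y - x))"
    if "{x, y} = {p, p'}" for x y t
    using that assms(3) by (auto simp: doubleton_eq_iff \<beta> \<gamma> algebra_simps power2_eq_square)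
  have d2: "t * (2 * \<alpha> * x + \<beta>) + (\<alpha> * x^2 + 2 * \<beta> * x + 3 * \<gamma>) = \<alpha> * (x - y) * (t - x)"
    if "{x, y} = {p, p'}" for x y t
    using that assms(3) by (auto simp: doubleton_eq_iff \<beta> \<gamma> algebra_simps power2_eq_square)
  have quad: "\<alpha> * t^2 + \<beta> * t + \<gamma> = \<alpha> * (t - x) * (t - y)" if "{x, y} = {p, p'}" for x y t
    using that unfolding assms(2) by (auto simp: doubleton_eq_iff algebra_simps)
  have fin: "(Some x, Some t) \<in> singular_poncelet_params \<longleftrightarrow> t = 2 * y - x"
    if xy: "{x, y} = {p, p'}" for x y t
  proof -
    have "x \<noteq> y" using xy assms(3) by auto
    have disc: "(\<alpha> * (t - x) * (t - (2 * y - x)))\<^sup>2 - 4 * (\<alpha> * (t - x) * (t - y)) * (\<alpha> * (x - y) * (t - x))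
       = (\<alpha> * (t - x) * (t - x))\<^sup>2"
      by (simp add: algebra_simps power2_eq_square)
    have "(Some x, Some t) \<in> singular_poncelet_params \<longleftrightarrow> t \<noteq> x \<and> t \<noteq> y \<and>
       \<alpha> * (t - x) * (t - (2 * y - x)) * (\<alpha> * (t - x) * (t - x))\<^sup>2 = 0"
      unfolding singular_poncelet_params_iff mixed_det_conic det_conic d1[OF xy] d2[OF xy] quad[OF xy] disc
      using xy by (auto simp: S doubleton_eq_iff)
    also have "\<dots> \<longleftrightarrow> t = 2 * y - x"
    proof -
      have "2 * (y - x) \<noteq> 0" using two \<open>x \<noteq> y\<close> by simp
      then have "2 * y - x \<noteq> x" by (auto simp: algebra_simps mult_2 diff_eq_eq)
      then show ?thesis using assms(1) \<open>x \<noteq> y\<close> by auto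
    qed
    finally show ?thesis .
  qed
  note fin1 = fin[of p p', OF refl] and fin2 = fin[of p' p, OF insert_commute]
  have inf: "(None, Some t) \<in> singular_poncelet_params \<longleftrightarrow> t = (p + p') / 2" for t
  proof -
    have disc: "(\<alpha> * (2 * t - (p + p')))\<^sup>2 - 4 * (\<alpha> * (t - p) * (t - p')) * \<alpha> = (\<alpha> * (p - p'))\<^sup>2"
      by (simp add: algebra_simps power2_eq_square)
    have "(None, Some t) \<in> singular_poncelet_params \<longleftrightarrow> t \<noteq> p \<and> t \<noteq> p' \<and>
       \<alpha> * (2 * t - (p + p')) * (\<alpha> * (p - p'))\<^sup>2 = 0"
      unfolding singular_poncelet_params_iff mixed_det_conic det_conic f' assms(2) disc
      by (auto simp: S)
    also have "\<dots> \<longleftrightarrow> t \<noteq> p \<and> t \<noteq> p' \<and> 2 * t = p + p'"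
      using assms(1,3) by simp
    also have "\<dots> \<longleftrightarrow> t = (p + p') / 2"
      using two assms(3) by (auto simp: field_simps)
    finally show ?thesis .
  qed
  let ?D = "{(None, Some ((p + p') / 2)), (Some p, Some (2 * p' - p)), (Some p', Some (2 * p - p'))}"
  have pairs: "(r, s) \<in> singular_poncelet_params \<longleftrightarrow> (r, s) \<in> ?D" for r s
  proof (cases "r \<in> singular_params \<and> s \<notin> singular_params")
    case False
    then have "(r, s) \<notin> singular_poncelet_params" by (auto simp: singular_poncelet_params_iff)
    moreover have "(r, s) \<notin> ?D"
    proof
      assume "(r, s) \<in> ?D"
      then have "(r, s) \<in> singular_poncelet_params"
        using inf fin1 fin2 by auto
      then show False using \<open>(r, s) \<notin> singular_poncelet_params\<close> by simp
    qed
    ultimately show ?thesis by blast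
  next
    case True
    then obtain t where "s = Some t" "r \<in> {None, Some p, Some p'}" unfolding S by (cases s) auto
    then show ?thesis
      using inf fin1 fin2 assms(3) two by auto
  qed
  have D: "singular_poncelet_params = ?D"
    by (rule Set.set_eqI) (simp only: split_paired_all pairs)
  have V_inf: "mixed_det (conic None) (conic (Some ((p + p') / 2))) = 0"
    "mixed_det (conic (Some ((p + p') / 2))) (conic None) \<noteq> 0"
    unfolding mixed_det_conic f' using two assms(1) by simp_all
  have V_fin: "mixed_det (conic (Some x)) (conic (Some (2 * y - x))) = 0"
    "mixed_det (conic (Some (2 * y - x))) (conic (Some x)) \<noteq> 0"
    if xy: "{x, y} = {p, p'}" for x y
  proof -
    show "mixed_det (conic (Some x)) (conic (Some (2 * y - x))) = 0"
      unfolding mixed_det_conic d1[OF xy] by simp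
    have "x \<noteq> y" using xy assms(3) by auto
    moreover have "2 * y - x - x = 2 * (y - x)" by (simp add: algebra_simps)
    ultimately show "mixed_det (conic (Some (2 * y - x))) (conic (Some x)) \<noteq> 0"
      unfolding mixed_det_conic d2[OF xy] using two assms(1) by simp
  qed
  have V: "singular_valid_params = singular_poncelet_params"
    unfolding singular_valid_params_def D
    using V_inf V_fin[of p p', OF refl] V_fin[of p' p, OF insert_commute] by blast
  have "card {None, Some p, Some p'} \<le> CARD('a option)"
    by (rule card_mono) auto
  then have q: "CARD('a) \<ge> 2" using assms(3) by simp
  have D3: "card singular_poncelet_params = 3" and S3: "card singular_params = 3"
    unfolding D S using assms(3) by auto
  \<comment> \<open>For \<open>q \<ge> 3\<close> the difference \<open>3 (q - 2) - 3\<close> of natural numbers does not truncate.\<close>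
  have "CARD('a) \<noteq> 2"
  proof
    assume "CARD('a) = 2"
    then have "card {0, 1::'a} = CARD('a)" by simp
    then have "UNIV = {0, 1::'a}" by (metis card_subset_eq finite subset_UNIV)
    then have "(2::'a) \<in> {0, 1}" by blast
    then have "(2::'a) = 1" using two by simp
    then show False by (metis add_cancel_right_right one_add_one one_neq_zero)
  qed
  with q have "CARD('a) \<ge> 3" by simp
  then show "int (M_sm (A, B)) = 3 * (int CARD('a) - 3)"
    unfolding M_sm_eq card_poncelet_params D3 S3
    by (simp add: of_nat_diff)
  then show "int (M_val (A, B)) = 3 * (int CARD('a) - 2)"
    by (simp add: M_val_eq V D3)
qed

end

section \<open>Roots and squares in finite fields\<close>

lemma irreducible_poly_no_root:
  fixes p :: "'a::field poly"
  assumes "Factorial_Ring.irreducible p" "Polynomial.degree p \<ge> 2"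
  shows "poly p t \<noteq> 0"
proof
  assume "poly p t = 0"
  then obtain k where p: "p = [:-t, 1:] * k"
    unfolding poly_eq_0_iff_dvd by (elim dvdE)
  have "k \<noteq> 0" using p assms(2) by auto
  moreover have "[:-t, 1:] dvd 1 \<or> k dvd 1"
    using assms(1) p by (rule Factorial_Ring.irreducibleD)
  then have "Polynomial.degree k = 0"
    using \<open>k \<noteq> 0\<close> by (auto simp: is_unit_iff_degree)
  ultimately have "Polynomial.degree p = 1"
    unfolding p by (subst Polynomial.degree_mult_eq) auto
  then show False using assms(2) by simp
qed

text \<open>Let \<open>S\<close> be the set of nonzero squares. Squaring is at most two-to-one, so there are at most
  \<open>2 |S|\<close> nonzero elements. If \<open>m n\<close> were not a square, then \<open>S\<close>, \<open>n
  S\<close>, \<open>m S\<close> would be pairwise disjoint, which needs \<open>3 |S|\<close> of them.\<close>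

lemma nonsquare_mult_nonsquare:
  fixes m n :: "'a::{field,finite}"
  assumes m: "\<nexists>w. m = w^2" and n: "\<nexists>w. n = w^2"
  shows "\<exists>w. m * n = w^2"
proof (rule ccontr)
  assume mn: "\<nexists>w. m * n = w^2"
  define U where "U = - {0::'a}"
  define S where "S = (\<lambda>x. x^2) ` U"
  define r where "r = (\<lambda>y::'a. SOME x. x^2 = y)"
  have nz: "m \<noteq> 0" "n \<noteq> 0" using m n by (metis zero_power2)+
  have "x \<in> r ` S \<union> (\<lambda>y. - r y) ` S" if "x \<in> U" for x
  proof -
    have "(r (x^2))^2 = x^2"
      unfolding r_def by (rule someI) simp
    then have "r (x^2) = x \<or> r (x^2) = - x"
      by (simp only: power2_eq_iff)
    then have "x = r (x^2) \<or> x = - r (x^2)" by auto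
    moreover have "x^2 \<in> S" using that by (simp add: S_def)
    ultimately show ?thesis by blast
  qed
  then have "card U \<le> card (r ` S \<union> (\<lambda>y. - r y) ` S)"
    by (intro card_mono) auto
  also have "\<dots> \<le> card S + card S"
    by (intro order.trans[OF card_Un_le] add_mono card_image_le) simp_all
  finally have le: "card U \<le> 2 * card S" by simp
  have S0: "s \<noteq> 0 \<and> (\<exists>x. x \<noteq> 0 \<and> s = x^2)" if "s \<in> S" for s
    using that by (auto simp: S_def U_def)
  have disj: "k * s \<noteq> t" if s: "s \<in> S" and t: "t \<in> S" and k: "\<nexists>w. k = w^2" for k s t
  proof
    assume "k * s = t"
    obtain x y where "x \<noteq> 0" "s = x^2" "t = y^2" using S0[OF s] S0[OF t] by blast
    then have "k = (y / x)^2" using \<open>k * s = t\<close> by (auto simp: field_simps)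
    then show False using k by blast
  qed
  have d: "S \<inter> (*) n ` S = {}" "S \<inter> (*) m ` S = {}"
    using disj[OF _ _ n] disj[OF _ _ m] by blast+
  have d': "(*) n ` S \<inter> (*) m ` S = {}"
  proof (rule ccontr)
    assume "\<not> ?thesis"
    then obtain s t where st: "s \<in> S" "t \<in> S" "n * s = m * t" by blast
    then obtain x where x: "x \<noteq> 0" "t = x^2" using S0 by blast
    have "(m * n) * s = (m * x)^2"
      using st x by (simp add: power2_eq_square ac_simps)
    moreover have "(m * x)^2 \<in> S" using x nz by (simp add: S_def U_def)
    ultimately show False using disj[OF st(1) _ mn] by blast
  qed
  have c: "card ((*) k ` S) = card S" if "k \<noteq> 0" for k
    using that by (intro card_image) (auto simp: inj_on_def)
  have "card (S \<union> ((*) n ` S \<union> (*) m ` S)) = card S + (card S + card S)"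
    using d d' c nz by (subst card_Un_disjoint, simp, simp, blast, subst card_Un_disjoint) auto
  moreover have "card (S \<union> ((*) n ` S \<union> (*) m ` S)) \<le> card U"
    using S0 nz by (intro card_mono) (auto simp: U_def)
  moreover have "1 \<in> S" unfolding S_def U_def by (intro image_eqI[of _ _ 1]) auto
  then have "card S > 0" by (auto simp: card_gt_0_iff)
  ultimately show False using le by simp
qed

section \<open>The eleven pencils\<close>

lemma transpose_qf_matrix: "transpose (qf_matrix a b c f g h) = qf_matrix a b c f g h"
  by (simp add: vec3_eq_iff transpose_def qf_matrix_def)

lemma four_neq_0: "(2::'a::field) \<noteq> 0 \<Longrightarrow> (4::'a) \<noteq> 0"
  using power_eq_0_iff[of "2::'a" 2] by simp

lemma eighth_add_eighth:
  assumes two: "(2::'a::field) \<noteq> 0"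
  shows "x / 8 + x / 8 = (x::'a) / 4"
proof -
  have "x / 8 + x / 8 = 2 * x / (2 * 4)" by (simp add: add_divide_distrib[symmetric])
  also have "\<dots> = x / 4" by (rule mult_divide_mult_cancel_left[OF two])
  finally show ?thesis .
qed

lemma pencil_xy:
  assumes two: "(2::'a::{field,finite}) \<noteq> 0"
  shows "pencil_singular_at_infinity (qf_matrix 0 0 0 1 0 0) (qf_matrix a b c 0 g h)
     (- c / 4) (g * h / 4) (a * b * c - a * h^2 / 4 - b * g^2 / 4 :: 'a)"
proof
  show "mixed_det (qf_matrix 0 0 0 1 0 0) (qf_matrix a b c 0 g h) = g * h / 4"
    using eighth_add_eighth[OF two, of "g * h"]
    by (simp add: mixed_det_expand det_3 qf_matrix_def ac_simps)
  show "det (qf_matrix a b c 0 g h) = a * b * c - a * h^2 / 4 - b * g^2 / 4"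
    by (simp add: det_3 qf_matrix_def power2_eq_square ac_simps)
qed (simp_all add: two transpose_qf_matrix,
     simp_all add: mixed_det_expand det_3 qf_matrix_def)

lemma pencil_xx:
  assumes two: "(2::'a::{field,finite}) \<noteq> 0"
  shows "pencil_singular_at_infinity (qf_matrix 1 0 0 0 0 0) (qf_matrix 0 b c f 0 h)
     0 (b * c - h^2 / 4) (- c * f^2 / 4 :: 'a)"
proof
  show "mixed_det (qf_matrix 1 0 0 0 0 0) (qf_matrix 0 b c f 0 h) = b * c - h^2 / 4"
    by (simp add: mixed_det_expand det_3 qf_matrix_def power2_eq_square)
  show "det (qf_matrix 0 b c f 0 h) = - c * f^2 / 4"
    by (simp add: det_3 qf_matrix_def power2_eq_square ac_simps)
qed (simp_all add: two transpose_qf_matrix,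
     simp_all add: mixed_det_expand det_3 qf_matrix_def)

lemma pencil_P19:
  assumes two: "(2::'a::{field,finite}) \<noteq> 0"
  shows "pencil_singular_at_infinity (qf_matrix 1 (-\<nu>) 0 0 0 0) (qf_matrix 0 (-\<rho>) 1 (2 * \<sigma>) 0 0)
     (- \<nu>) (- \<rho>) (- (\<sigma>^2) :: 'a)"
proof
  show "det (qf_matrix 0 (- \<rho>) 1 (2 * \<sigma>) 0 0) = - (\<sigma>^2)"
    using two by (simp add: det_3 qf_matrix_def power2_eq_square)
qed (simp_all add: two transpose_qf_matrix,
     simp_all add: mixed_det_expand det_3 qf_matrix_def)

text \<open>The finite singular parameters are \<open>(1 \<plusminus> w) / 2\<close>. The case \<open>d = e =
  0\<close>, \<open>w = 1\<close> is the pencil \<open>P3\<close>.\<close>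

lemma count_two_finite_roots_P16:
  fixes d e w :: "'a::{field,finite}"
  assumes two: "(2::'a) \<noteq> 0" and w: "(1 - 4 * d) * (1 - 4 * e) = w^2" "w \<noteq> 0"
  shows "int (M_sm (P16 d e)) = 3 * (int CARD('a) - 3)" "int (M_val (P16 d e)) = 3 * (int CARD('a) - 2)"
proof -
  note four = four_neq_0[OF two]
  interpret pencil_singular_at_infinity "qf_matrix 0 0 0 1 0 0" "qf_matrix e d 1 0 1 1"
    "- 1 / 4 :: 'a" "1 * 1 / 4" "e * d * 1 - e * 1^2 / 4 - d * 1^2 / 4"
    by (rule pencil_xy[OF two])
  define x y where "x = (1 + w) / 2" and "y = (1 - w) / 2"
  have sum: "x + y = 1"
    unfolding x_def y_def add_divide_distrib[symmetric] using two by simp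
  have "4 * (x * y) = (2 * x) * (2 * y)"
    by simp
  also have "\<dots> = 1 - w^2"
    unfolding x_def y_def times_divide_eq_right nonzero_mult_div_cancel_left[OF two]
    by (simp add: algebra_simps power2_eq_square)
  also have "\<dots> = 4 * (d + e - 4 * e * d)"
    unfolding w(1)[symmetric] by (simp add: algebra_simps)
  finally have prod: "x * y = d + e - 4 * e * d"
    unfolding mult_left_cancel[OF four] .
  have "(- 1 / 4) * t^2 + (1 * 1 / 4) * t + (e * d * 1 - e * 1^2 / 4 - d * 1^2 / 4) =
     (- 1 / 4) * (t - x) * (t - y)" for t
  proof -
    have "(t - x) * (t - y) = t^2 - (x + y) * t + x * y"
      by (simp add: algebra_simps power2_eq_square)
    then have "(- 1 / 4) * (t - x) * (t - y) = (- 1 / 4) * (t^2 - (x + y) * t + x * y)"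
      by (simp only: mult.assoc)
    also have "\<dots> = (- 1 / 4) * t^2 + (1 * 1 / 4) * t + (e * d * 1 - e * 1^2 / 4 - d * 1^2 / 4)"
      unfolding sum prod using four
      by (simp add: diff_divide_distrib add_divide_distrib ac_simps)
    finally show ?thesis by simp
  qed
  moreover have "x \<noteq> y"
  proof
    assume "x = y"
    then have "2 * ((1 + w) / 2) = 2 * ((1 - w) / 2)" by (simp only: x_def y_def)
    then have "1 + w = 1 - w"
      unfolding times_divide_eq_right nonzero_mult_div_cancel_left[OF two] .
    moreover have "2 * w = (1 + w) - (1 - w)" by simp
    ultimately have "2 * w = 0" by (simp only: diff_self)
    then show False using two w(2) by simp
  qed
  ultimately show "int (M_sm (P16 d e)) = 3 * (int CARD('a) - 3)" "int (M_val (P16 d e)) = 3 * (int CARD('a) - 2)"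
    unfolding P16_def using two_finite_roots[of x y] four by simp_all
qed

theorem theorem3p23:
  fixes b c d e \<nu> \<rho> \<sigma> :: "'a::{field,finite}" and q :: int
  assumes "CHAR('a) \<noteq> 2"
    and "q = int CARD('a)"
    and "Factorial_Ring.irreducible [:1, c, b, 1:]"
    and "Factorial_Ring.irreducible [:d, 1, 1:]"
    and "Factorial_Ring.irreducible [:e, 1, 1:]"
    and "\<nexists>w. \<nu> = w^2"
    and "\<nexists>w. \<rho>^2 - 4 * \<nu> * \<sigma>^2 = w^2"
  shows "(\<forall>P \<in> {P3, P16 d e}. int (M_sm P) = 3 * (q - 3) \<and> int (M_val P) = 3 * (q - 2)) \<and>
         (\<forall>P \<in> {P4, P6, P15 e, P17 e}. int (M_sm P) = q - 1 \<and> int (M_val P) = q - 1) \<and>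
         (\<forall>P \<in> {P5, P8 :: 'a pencil}. M_sm P = 0 \<and> M_val P = 0) \<and>
         (\<forall>P \<in> {P14 e, P19 \<nu> \<rho> \<sigma>}. int (M_sm P) = q - 1 \<and> int (M_val P) = q) \<and>
         M_sm (P18 b c) = 0 \<and> M_val (P18 b c) = 0"
proof -
  have two: "(2::'a) \<noteq> 0"
  proof
    assume "(2::'a) = 0"
    then have "of_nat 2 = (0::'a)" by simp
    then have "CHAR('a) dvd 2" by (simp only: of_nat_eq_0_iff_char_dvd)
    then have "CHAR('a) = 1 \<or> CHAR('a) = 2"
      using two_is_prime_nat by (auto simp: prime_nat_iff)
    then show False using assms(1) by simp
  qed
  note four = four_neq_0[OF two]
  note q = assms(2)
  have root: "t^2 + t + x \<noteq> 0" if "Factorial_Ring.irreducible [:x, 1, 1:]" for x t :: 'a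
    using irreducible_poly_no_root[OF that, of t] by (simp add: algebra_simps power2_eq_square)
  have root3: "t^3 + b * t^2 + c * t + 1 \<noteq> 0" for t
    using irreducible_poly_no_root[OF assms(3), of t] by (simp add: algebra_simps power2_eq_square power3_eq_cube)
  have nonsquare: "\<nexists>w. 1 - 4 * x = w^2" if "Factorial_Ring.irreducible [:x, 1, 1:]" for x :: 'a
  proof
    assume "\<exists>w. 1 - 4 * x = w^2"
    then obtain w where w: "1 - 4 * x = w^2" ..
    define t where "t = (w - 1) / 2"
    have "w = 2 * t + 1"
      unfolding t_def times_divide_eq_right nonzero_mult_div_cancel_left[OF two] by simp
    then have "4 * (t^2 + t + x) = 0" using w by (simp add: algebra_simps power2_eq_square)
    then have "t^2 + t + x = 0" using four by (simp only: mult_eq_0_iff simp_thms)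
    then show False using root[OF that] by blast
  qed
  have e: "e \<noteq> 0" "1 - 4 * e \<noteq> 0"
    using root[OF assms(5), of 0] nonsquare[OF assms(5)] by (simp, metis zero_power2)
  have \<nu>: "\<nu> \<noteq> 0" using assms(6) by (metis zero_power2)
  \<comment> \<open>Both factors are discriminants of irreducible quadratic polynomials, so their product is a square.\<close>
  obtain w where w: "(1 - 4 * d) * (1 - 4 * e) = w^2"
    using nonsquare_mult_nonsquare nonsquare assms(4,5) by blast
  have "1 - 4 * d \<noteq> 0" using nonsquare[OF assms(4)] by (metis zero_power2)
  then have "w \<noteq> 0" using w e by auto
  note P16 = count_two_finite_roots_P16[OF two w \<open>w \<noteq> 0\<close>, folded q]
  have "P3 = P16 (0::'a) 0" by (simp add: P3_def P16_def)
  then have P3: "int (M_sm (P3::'a pencil)) = 3 * (q - 3)" "int (M_val (P3::'a pencil)) = 3 * (q - 2)"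
    using count_two_finite_roots_P16[OF two, of 0 0 1] q by simp_all

  note xy = pencil_xy[OF two] and xx = pencil_xx[OF two]
  note DR = pencil_singular_at_infinity.double_root[OF xy, folded q]
  have P4: "int (M_sm (P4::'a pencil)) = q - 1" "int (M_val (P4::'a pencil)) = q - 1"
    unfolding P4_def by (rule DR; use four in simp)+
  have P6: "int (M_sm (P6::'a pencil)) = q - 1" "int (M_val (P6::'a pencil)) = q - 1"
    unfolding P6_def by (rule DR; use four in simp)+
  have P15: "int (M_sm (P15 e)) = q - 1" "int (M_val (P15 e)) = q - 1"
    unfolding P15_def by (rule DR; use four e in simp)+
  have ne: "1 * e - 1^2 / 4 \<noteq> 0" using e(2) four by (auto simp: field_simps)
  have P17: "int (M_sm (P17 e)) = q - 1" "int (M_val (P17 e)) = q - 1"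
    unfolding P17_def
    by (rule pencil_singular_at_infinity.simple_root[OF xx, folded q]; use ne in simp)+
  have P5: "M_sm (P5::'a pencil) = 0" "M_val (P5::'a pencil) = 0"
    unfolding P5_def
    by (rule pencil_singular_at_infinity.constant_det[OF xy]; use four in simp)+
  have P8: "M_sm (P8::'a pencil) = 0" "M_val (P8::'a pencil) = 0"
    unfolding P8_def
    by (rule pencil_singular_at_infinity.constant_det[OF xx]; use four in simp)+
  have f14: "- e / 4 * t^2 + 1 * 1 / 4 * t + (0 * 1 * e - 0 * 1^2 / 4 - 1 * 1^2 / 4) \<noteq> 0" for t
  proof
    assume "- e / 4 * t^2 + 1 * 1 / 4 * t + (0 * 1 * e - 0 * 1^2 / 4 - 1 * 1^2 / 4) = 0"
    moreover have "- e / 4 * t^2 + 1 * 1 / 4 * t + (0 * 1 * e - 0 * 1^2 / 4 - 1 * 1^2 / 4) =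
        - (e * t^2 - t + 1) / 4"
      by (simp add: diff_divide_distrib add_divide_distrib)
    ultimately have t: "e * t^2 - t + 1 = 0"
      using four by (simp only: divide_eq_0_iff neg_equal_0_iff_equal simp_thms)
    then have "t \<noteq> 0" by auto
    \<comment> \<open>A root \<open>t\<close> would give the root \<open>- 1 / t\<close> of the irreducible polynomial with constant term \<open>e\<close>.\<close>
    then have "(- 1 / t)^2 + (- 1 / t) + e = (e * t^2 - t + 1) / t^2"
      by (simp add: field_simps power2_eq_square)
    then show False using t root[OF assms(5), of "- 1 / t"] by simp
  qed
  have P14: "int (M_sm (P14 e)) = q - 1" "int (M_val (P14 e)) = q"
    unfolding P14_def
    by (rule pencil_singular_at_infinity.no_finite_root[OF xy, folded q]; use four e f14 in simp)+
  have f19: "- \<nu> * t^2 + - \<rho> * t + - (\<sigma>^2) \<noteq> 0" for t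
  proof
    assume "- \<nu> * t^2 + - \<rho> * t + - (\<sigma>^2) = 0"
    moreover have "(2 * \<nu> * t + \<rho>)^2 = \<rho>^2 - 4 * \<nu> * \<sigma>^2 - 4 * \<nu> * (- \<nu> * t^2 + - \<rho> * t + - (\<sigma>^2))"
      by (simp add: algebra_simps power2_eq_square)
    ultimately have "\<rho>^2 - 4 * \<nu> * \<sigma>^2 = (2 * \<nu> * t + \<rho>)^2" by simp
    then show False using assms(7) by blast
  qed
  have P19: "int (M_sm (P19 \<nu> \<rho> \<sigma>)) = q - 1" "int (M_val (P19 \<nu> \<rho> \<sigma>)) = q"
    unfolding P19_def
    using pencil_singular_at_infinity.no_finite_root[OF pencil_P19[OF two], folded q, OF _ f19] \<nu> by simp_all
  let ?A = "qf_matrix 0 1 0 0 (-1) 0 :: 'a^3^3" and ?B = "qf_matrix 1 b 0 c 0 1"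
  interpret P18: symmetric_pencil ?A ?B
    by standard (simp_all add: transpose_qf_matrix two)
  have dets: "det ?A = - 1 / 4" "mixed_det ?B ?A = - b / 4" "mixed_det ?A ?B = - c / 4" "det ?B = - 1 / 4"
    using eighth_add_eighth[OF two, of c]
    by (simp_all add: mixed_det_expand det_3 qf_matrix_def ac_simps)
  have "r \<notin> P18.singular_params" for r
  proof (cases r)
    case None
    then have "det (P18.conic r) = - 1 / 4"
      by (simp add: pencil_conic_eq_comb det_comb dets)
    then show ?thesis using four by (simp add: P18.singular_params_def)
  next
    case (Some t)
    then have "det (P18.conic r) = - (t^3 + b * t^2 + c * t + 1) / 4"
      by (simp add: pencil_conic_eq_comb det_comb dets add_divide_distrib diff_divide_distrib ac_simps)
    then show ?thesis
      using four root3[of t]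
      by (simp only: P18.singular_params_def mem_Collect_eq divide_eq_0_iff neg_equal_0_iff_equal simp_thms)
  qed
  then have "P18.singular_params = {}" by blast
  then have P18: "M_sm (P18 b c) = 0" "M_val (P18 b c) = 0"
    unfolding P18_def using P18.no_singular_member by simp_all
  show ?thesis
    using P3 P16 P4 P6 P15 P17 P5 P8 P14 P19 P18 by simp
qed

end
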